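(* Let $v\equiv 1$ or $3\pmod 6$, let $k$ be the largest integer such that $3^k$ divides $v$, and let $i\in\{0,\ldots,k\}$. Then the total number of different STS$(v)$ on $\{1,\ldots,v\}$ of $3$-rank $v-i-1$ equals $$\Gamma_{v,0,i}\sum_{j=i}^k \Gamma_{v,i,j}\,\mu^{(3)}_{j-i}\,\Phi_{v,j},$$ where $\mu^{(3)}_l=(-1)^l3^{\binom{l}{2}}$, $\Phi_{v,j}=\Psi_{v/3^j}^{\,3^j}\Lambda_{v/3^j}^{\,3^j(3^j-1)/6}$, $$\Gamma_{v,i,j}=\left(\left(\tfrac{v}{3^i}\right)!\right)^{3^i}\Bigg/\left(3^{\frac{(j+i+1)(j-i)}{2}}\left(\left(\tfrac{v}{3^j}\right)!\right)^{3^j}\prod_{s=1}^{j-i}(3^s-1)\right),$$ $\Psi_u$ is the number of STS$(u)$ on $\{1,\ldots,u\}$, and $\Lambda_u$ is the number of latin squares of order $u$.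
   Context: A Steiner triple system STS$(v)$ on $\{1,\ldots,v\}$ is a collection of 3-subsets (blocks) such that every 2-subset is contained in exactly one block; systems are different when their block sets differ. The $3$-rank of an STS is the dimension of the $\mathrm{GF}(3)$-linear span of the characteristic vectors of its blocks in $\mathrm{GF}(3)^v$. A latin square of order $u$ is a function $f:\{1,\ldots,u\}^2\to\{1,\ldots,u\}$ that is bijective in each argument. Conventions: $\Psi_1=1$, and $\Psi_u=0$ when no STS$(u)$ exists. *)

theory Defs
  imports Complex_Main "HOL-Library.FuncSet"
begin

definition is_STS :: "nat \<Rightarrow> nat set set \<Rightarrow> bool" where
  "is_STS v B \<longleftrightarrow>
     (\<forall>b\<in>B. b \<subseteq> {1..v} \<and> card b = 3) \<and>
     (\<forall>p. p \<subseteq> {1..v} \<and> card p = 2 \<longrightarrow> (\<exists>!b. b \<in> B \<and> p \<subseteq> b))"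

text \<open>Characteristic vector of a block, with entries in {0,1} (integers representing GF(3)).\<close>
definition chi :: "nat set \<Rightarrow> nat \<Rightarrow> int" where
  "chi b x = (if x \<in> b then 1 else 0)"

definition gf3_independent :: "nat \<Rightarrow> nat set set \<Rightarrow> bool" where
  "gf3_independent v S \<longleftrightarrow>
     (\<forall>c :: nat set \<Rightarrow> int.
        (\<forall>x\<in>{1..v}. (\<Sum>b\<in>S. c b * chi b x) mod 3 = 0) \<longrightarrow> (\<forall>b\<in>S. c b mod 3 = 0))"

text \<open>3-rank: dimension of the GF(3)-span of the characteristic vectors of the blocks,
  i.e. the maximal size of a GF(3)-linearly independent subfamily of blocks.\<close>
definition three_rank :: "nat \<Rightarrow> nat set set \<Rightarrow> nat" where
  "three_rank v B = Max {card S | S. S \<subseteq> B \<and> gf3_independent v S}"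

definition Psi :: "nat \<Rightarrow> nat" where
  "Psi u = card {B. is_STS u B}"

definition latin_squares :: "nat \<Rightarrow> (nat \<times> nat \<Rightarrow> nat) set" where
  "latin_squares u = {f \<in> ({1..u} \<times> {1..u}) \<rightarrow>\<^sub>E {1..u}.
      (\<forall>a\<in>{1..u}. bij_betw (\<lambda>b. f (a, b)) {1..u} {1..u}) \<and>
      (\<forall>b\<in>{1..u}. bij_betw (\<lambda>a. f (a, b)) {1..u} {1..u})}"

definition Lambda :: "nat \<Rightarrow> nat" where
  "Lambda u = card (latin_squares u)"

definition mu3 :: "nat \<Rightarrow> real" where
  "mu3 l = (-1) ^ l * 3 ^ (l choose 2)"

definition Phi :: "nat \<Rightarrow> nat \<Rightarrow> real" where
  "Phi v j = real (Psi (v div 3 ^ j)) ^ (3 ^ j) *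
             real (Lambda (v div 3 ^ j)) ^ (3 ^ j * (3 ^ j - 1) div 6)"

definition Gamma :: "nat \<Rightarrow> nat \<Rightarrow> nat \<Rightarrow> real" where
  "Gamma v i j = (fact (v div 3 ^ i)) ^ (3 ^ i) /
     (3 ^ ((j + i + 1) * (j - i) div 2) * (fact (v div 3 ^ j)) ^ (3 ^ j) *
      (\<Prod>s = 1..j - i. (3 ^ s - 1)))"

end

theory Submission
  imports Defs "HOL-Library.Numeral_Type" "HOL-Library.Function_Algebras"
begin

text \<open>Functions \<open>f : {1..v} \<rightarrow> GF(3)\<close> with sum zero on every block of an STS form a space of dimension
  \<open>v - rank = d + 1\<close>. Tuples of \<open>j\<close> such functions are the maps \<open>f : {1..v} \<rightarrow> GF(3)\<^sup>j\<close> that send blocks to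
  lines or points. Such an \<open>f\<close> extends by a further coordinate \<open>g\<close> to a surjection onto \<open>GF(3)\<^sup>j\<^sup>+\<^sup>1\<close> unless \<open>g\<close>
  is an affine function of \<open>f\<close>, so an STS admits \<open>\<Prod>t<j. (3\<^sup>d\<^sup>+\<^sup>1 - 3\<^sup>t\<^sup>+\<^sup>1)\<close> surjective ones. All fibres of a
  surjective \<open>f\<close> have size \<open>u = v/3\<^sup>j\<close>; conversely, for a fixed \<open>f\<close> with such fibres, an STS mapped by \<open>f\<close> to
  points and lines is an independent choice of an STS on each fibre and of a latin square of order \<open>u\<close>
  for each line. Counting the pairs (STS, \<open>f\<close>) in both ways and inverting the resulting triangular
  system by the alternating sum of Gaussian binomials gives the formula.\<close>


section \<open>Characters of GF(3) and the dual of a block set\<close>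

text \<open>The 3-rank enters only through the identity
  \<open>card (dual {1..v} B) * 3 ^ three_rank v B = 3 ^ v\<close>, which is obtained by counting
  with a complex character and needs no dimension theory. The summand 1 in the dimension
  \<open>d + 1\<close> comes from the constant functions: a block has three points, so they have sum
  zero on it. The obstacle is that the rank cannot be prescribed while a system is assembled from
  its fibres. The local choices guarantee that a given \<open>f\<close> is a homomorphism but do not
  control how many further ones exist. Every system with \<open>d \<ge> j\<close> is therefore
  produced, with a multiplicity that depends on \<open>d\<close> and \<open>j\<close> alone, and the
  exact value of \<open>d\<close> has to be recovered by inversion. Triangularity holds because the
  multiplicity contains a zero factor once \<open>j > d\<close>; the range ends at \<open>k\<close>
  because equal fibres over \<open>3 ^ j\<close> points force \<open>3 ^ j\<close> to divide
  \<open>v\<close>. The product \<open>Gamma v 0 i * Gamma v i j\<close> is, up to factorials and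
  the sign and power in \<open>mu3\<close>, the inversion coefficient.\<close>

lemma UNIV_3: "(UNIV :: 3 set) = {0, 1, 2}"
proof -
  have "card {0, 1, 2 :: 3} = 3" by simp
  then show ?thesis
    by (intro card_subset_eq[symmetric]) auto
qed

lemma cases_3: obtains "(t :: 3) = 0" | "t = 1" | "t = 2"
  using UNIV_3 by blast

lemma triple_3: "(t :: 3) + t + t = 0"
  by (cases t rule: cases_3) auto

text \<open>\<open>gf3_independent\<close> speaks of integer coefficients modulo 3, the counting
  below of the ring type \<open>3\<close>; this equivalence and \<open>of_int_3_surj\<close>
  translate between the two.\<close>

lemma of_int_3_eq_0_iff: "of_int c = (0 :: 3) \<longleftrightarrow> c mod 3 = 0"
proof -
  define d where "d = c div 3"
  have "c = (d + d + d) + c mod 3"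
    by (simp add: d_def)
  then have "of_int c = (of_int ((d + d + d) + c mod 3) :: 3)"
    by (rule arg_cong)
  also have "\<dots> = of_int (c mod 3)"
    by (simp only: of_int_add triple_3 add_0_left)
  finally have eq: "of_int c = (of_int (c mod 3) :: 3)" .
  have "c mod 3 = 0 \<or> c mod 3 = 1 \<or> c mod 3 = 2"
    by presburger
  then show ?thesis
    unfolding eq by auto
qed

lemma of_int_3_surj: obtains c where "(t :: 3) = of_int c"
proof (cases t rule: cases_3)
  case 1 then show ?thesis using that[of 0] by simp
next
  case 2 then show ?thesis using that[of 1] by simp
next
  case 3 then show ?thesis using that[of 2] by simp
qed

lemma mult_3_eq_0: "(s :: 3) * t = 0 \<longleftrightarrow> s = 0 \<or> t = 0"
  by (cases s rule: cases_3; cases t rule: cases_3) auto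

section \<open>The nontrivial additive character of GF(3) and its orthogonality relation\<close>

definition omega :: complex where "omega = Complex (- 1 / 2) (sqrt 3 / 2)"

text \<open>The additive character sending \<open>t\<close> to \<open>omega ^ t\<close>, written by
  cases because the exponent lives in \<open>3\<close>.\<close>

definition char3 :: "3 \<Rightarrow> complex"
  where "char3 t = (if t = 0 then 1 else if t = 1 then omega else omega\<^sup>2)"

lemma omega_sq: "omega\<^sup>2 = - 1 - omega"
  by (simp add: omega_def power2_eq_square complex_eq_iff)

lemma omega_cube: "omega * (omega * omega) = 1"
  by (simp add: omega_def complex_eq_iff)

lemma char3_0 [simp]: "char3 0 = 1"
  by (simp add: char3_def)

lemma char3_add: "char3 (s + t) = char3 s * char3 t"
  using omega_cube by (cases s rule: cases_3; cases t rule: cases_3)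
    (simp_all add: char3_def power2_eq_square mult.assoc)

lemma char3_sum: "char3 (\<Sum>x\<in>A. f x) = (\<Prod>x\<in>A. char3 (f x))"
  by (induction A rule: infinite_finite_induct) (auto simp: char3_add)

lemma sum_char3_mult: "(\<Sum>t\<in>UNIV. char3 (t * w)) = (if w = 0 then 3 else 0)"
proof -
  have "(\<Sum>t\<in>UNIV. char3 (t * w)) = char3 0 + char3 w + char3 (2 * w)"
    by (subst UNIV_3) simp
  then show ?thesis
    by (cases w rule: cases_3) (simp_all add: char3_def omega_sq)
qed

text \<open>The character of a sum is a product of characters, so the sum over all \<open>f\<close>
  splits into one factor per coordinate, and a single coordinate with \<open>w x \<noteq> 0\<close>
  makes it vanish.\<close>

lemma sum_char3_PiE:
  assumes "finite A"
  shows "(\<Sum>f\<in>A \<rightarrow>\<^sub>E UNIV. char3 (\<Sum>x\<in>A. f x * w x)) =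
    (if \<forall>x\<in>A. w x = 0 then 3 ^ card A else 0)"
proof -
  have "(\<Sum>f\<in>A \<rightarrow>\<^sub>E UNIV. char3 (\<Sum>x\<in>A. f x * w x)) =
      (\<Prod>x\<in>A. \<Sum>t\<in>UNIV. char3 (t * w x))"
    using assms by (subst prod_sum_PiE) (auto simp: char3_sum)
  also have "\<dots> = (if \<forall>x\<in>A. w x = 0 then 3 ^ card A else 0)"
    using assms by (auto simp: sum_char3_mult)
  finally show ?thesis .
qed

text \<open>With \<open>G\<close> all of \<open>3\<close> these are the words orthogonal to every
  block; with \<open>coords j\<close> they are tuples of \<open>j\<close> such words. Extensionality
  on \<open>X\<close> makes each function count once.\<close>

definition homs :: "'a set \<Rightarrow> 'a set set \<Rightarrow> 'g::comm_monoid_add set \<Rightarrow> ('a \<Rightarrow> 'g) set"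
  where "homs X B G = {f \<in> X \<rightarrow>\<^sub>E G. \<forall>b\<in>B. (\<Sum>x\<in>b. f x) = 0}"

abbreviation dual :: "'a set \<Rightarrow> 'a set set \<Rightarrow> ('a \<Rightarrow> 3) set"
  where "dual X B \<equiv> homs X B UNIV"

section \<open>The size of the dual in terms of the 3-rank\<close>

lemma gf3_independent_iff:
  assumes "finite S"
  shows "gf3_independent v S \<longleftrightarrow>
    (\<forall>c :: nat set \<Rightarrow> 3. (\<forall>x\<in>{1..v}. (\<Sum>b\<in>S. c b * of_bool (x \<in> b)) = 0) \<longrightarrow> (\<forall>b\<in>S. c b = 0))"
    (is "_ \<longleftrightarrow> ?R")
proof -
  have *: "(\<Sum>b\<in>S. of_int (c b) * of_bool (x \<in> b) :: 3) = 0 \<longleftrightarrow>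
      (\<Sum>b\<in>S. c b * chi b x) mod 3 = 0" for c :: "nat set \<Rightarrow> int" and x
  proof -
    have "of_int (\<Sum>b\<in>S. c b * chi b x) = (\<Sum>b\<in>S. of_int (c b) * of_bool (x \<in> b) :: 3)"
      by (simp add: of_int_sum chi_def of_bool_def if_distrib cong: if_cong)
    then show ?thesis
      by (metis of_int_3_eq_0_iff)
  qed
  show ?thesis
  proof
    assume ind: "gf3_independent v S"
    show ?R
    proof (intro allI impI)
      fix c :: "nat set \<Rightarrow> 3"
      assume c: "\<forall>x\<in>{1..v}. (\<Sum>b\<in>S. c b * of_bool (x \<in> b)) = 0"
      have "\<forall>b. \<exists>d. c b = of_int d" by (metis of_int_3_surj)
      then obtain d where d: "\<And>b. c b = of_int (d b)" by metis
      show "\<forall>b\<in>S. c b = 0"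
        using ind c unfolding gf3_independent_def d by (auto simp: * of_int_3_eq_0_iff)
    qed
  next
    assume R: ?R
    show "gf3_independent v S"
      unfolding gf3_independent_def
    proof (intro allI impI)
      fix c :: "nat set \<Rightarrow> int"
      assume "\<forall>x\<in>{1..v}. (\<Sum>b\<in>S. c b * chi b x) mod 3 = 0"
      then show "\<forall>b\<in>S. c b mod 3 = 0"
        using R[rule_format, of "\<lambda>b. of_int (c b)"] by (simp add: * of_int_3_eq_0_iff)
    qed
  qed
qed

lemma sum_restrict_of_bool:
  fixes f :: "'a \<Rightarrow> 'b::semiring_1"
  assumes "b \<subseteq> X" "finite X"
  shows "(\<Sum>x\<in>X. f x * of_bool (x \<in> b)) = sum f b"
  using assms by (simp add: of_bool_def if_distrib sum.If_cases Int_absorb1 cong: if_cong)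

text \<open>Double counting of a character sum over all pairs of a function \<open>f\<close> and a
  coefficient vector \<open>c\<close>, with the pairing \<open>?p\<close>. Summed over
  \<open>f\<close> for fixed \<open>c\<close>, only combinations that vanish at every point survive,
  which by independence is \<open>c = 0\<close> alone; summed over \<open>c\<close> for fixed
  \<open>f\<close>, each \<open>f\<close> in the dual contributes \<open>3 ^ card S\<close>.\<close>

lemma card_dual_independent:
  assumes S: "S \<subseteq> Pow {1..v}" and ind: "gf3_independent v S"
  shows "card (dual {1..v} S) * 3 ^ card S = 3 ^ v"
proof -
  have fin: "finite S"
    using S by (rule finite_subset) auto
  let ?F = "{1..v} \<rightarrow>\<^sub>E (UNIV :: 3 set)" and ?C = "S \<rightarrow>\<^sub>E (UNIV :: 3 set)"
  let ?p = "\<lambda>f c. \<Sum>x\<in>{1..v}. f x * (\<Sum>b\<in>S. c b * of_bool (x \<in> b)) :: 3"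
  have p: "?p f c = (\<Sum>b\<in>S. c b * (\<Sum>x\<in>b. f x))" for f c
  proof -
    have "?p f c = (\<Sum>x\<in>{1..v}. \<Sum>b\<in>S. c b * (f x * of_bool (x \<in> b)))"
      by (simp only: sum_distrib_left mult.left_commute)
    also have "\<dots> = (\<Sum>b\<in>S. c b * (\<Sum>x\<in>{1..v}. f x * of_bool (x \<in> b)))"
      by (subst sum.swap) (simp only: sum_distrib_left)
    also have "\<dots> = (\<Sum>b\<in>S. c b * sum f b)"
      by (rule sum.cong[OF refl], subst sum_restrict_of_bool) (use S in auto)
    finally show ?thesis .
  qed
  \<comment> \<open>The zero coefficient vector, in its extensional form on
    \<open>S\<close>.\<close>
  obtain z where z: "z \<in> ?C" "\<And>b. b \<in> S \<Longrightarrow> z b = 0"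
    by (rule that[of "restrict (\<lambda>_. 0) S"]) auto
  have zero: "(\<forall>x\<in>{1..v}. (\<Sum>b\<in>S. c b * of_bool (x \<in> b)) = 0) \<longleftrightarrow> c = z"
    (is "?L \<longleftrightarrow> _") if "c \<in> ?C" for c
  proof
    assume ?L
    then have "\<forall>b\<in>S. c b = 0"
      using ind unfolding gf3_independent_iff[OF fin] by blast
    then show "c = z"
      using that by (intro PiE_ext[of c S "\<lambda>_. UNIV"]) (auto simp: z)
  next
    assume c: "c = z"
    show ?L
      unfolding c by (intro ballI sum.neutral) (simp add: z)
  qed
  have "(\<Sum>c\<in>?C. \<Sum>f\<in>?F. char3 (?p f c)) =
      (\<Sum>c\<in>?C. if c = z then 3 ^ v else 0)"
    by (intro sum.cong refl) (subst sum_char3_PiE, simp, subst zero, assumption, simp)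
  also have "\<dots> = 3 ^ v"
    using fin z(1) by (simp add: finite_PiE)
  finally have 1: "(\<Sum>c\<in>?C. \<Sum>f\<in>?F. char3 (?p f c)) = 3 ^ v" .
  have "(\<Sum>c\<in>?C. \<Sum>f\<in>?F. char3 (?p f c)) =
      (\<Sum>f\<in>?F. if \<forall>b\<in>S. sum f b = 0 then 3 ^ card S else 0)"
    by (subst sum.swap) (simp only: p sum_char3_PiE[OF fin])
  also have "\<dots> = of_nat (card (dual {1..v} S)) * 3 ^ card S"
    by (simp add: sum.If_cases homs_def finite_PiE Collect_conj_eq)
  finally have "of_nat (card (dual {1..v} S) * 3 ^ card S) = (of_nat (3 ^ v) :: complex)"
    using 1 by (simp only: of_nat_mult of_nat_power of_nat_numeral)
  then show ?thesis
    by (rule of_nat_eq_iff[THEN iffD1])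
qed

text \<open>An independent subfamily \<open>S\<close> of maximal size has the same dual as
  \<open>B\<close>: every other block depends on \<open>S\<close>, so a function with sum zero on
  the blocks of \<open>S\<close> has sum zero on it too.\<close>

lemma card_dual_three_rank:
  assumes B: "B \<subseteq> Pow {1..v}"
  shows "card (dual {1..v} B) * 3 ^ three_rank v B = 3 ^ v"
proof -
  let ?I = "{card S | S. S \<subseteq> B \<and> gf3_independent v S}"
  have fin: "finite B"
    using B by (rule finite_subset) auto
  have "?I \<subseteq> card ` Pow B" by auto
  then have finI: "finite ?I"
    by (rule finite_subset) (use fin in auto)
  have "gf3_independent v {}"
    by (simp add: gf3_independent_def)
  then have "?I \<noteq> {}" by blast
  then obtain S where S: "S \<subseteq> B" "gf3_independent v S" "three_rank v B = card S"
    using Max_in[OF finI] unfolding three_rank_def by auto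
  have finS: "finite S" using S fin finite_subset by blast
  have "sum f b = 0" if f: "f \<in> dual {1..v} S" and b: "b \<in> B" for f b
  proof (cases "b \<in> S")
    case True
    then show ?thesis using f by (simp add: homs_def)
  next
    case False
    have "\<not> gf3_independent v (insert b S)"
    proof
      assume "gf3_independent v (insert b S)"
      then have "card (insert b S) \<in> ?I" using S b by blast
      then have "card (insert b S) \<le> card S"
        using Max_ge[OF finI] S(3) by (simp add: three_rank_def)
      then show False using False finS by simp
    qed
    then obtain c :: "nat set \<Rightarrow> 3" where
      c: "\<And>x. x \<in> {1..v} \<Longrightarrow> (\<Sum>b\<in>insert b S. c b * of_bool (x \<in> b)) = 0"
      and nz: "\<exists>b\<in>insert b S. c b \<noteq> 0"
      using gf3_independent_iff[of "insert b S"] finS by blast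
    \<comment> \<open>The dependency must involve the new block; otherwise it would be a nontrivial
      relation inside the independent \<open>S\<close>.\<close>
    have cb: "c b \<noteq> 0"
    proof
      assume "c b = 0"
      have "\<forall>x\<in>{1..v}. (\<Sum>b\<in>S. c b * of_bool (x \<in> b)) = 0"
      proof
        fix x assume "x \<in> {1..v}"
        from c[OF this] show "(\<Sum>b\<in>S. c b * of_bool (x \<in> b)) = 0"
          by (simp only: sum.insert[OF finS False] \<open>c b = 0\<close> mult_zero_left add_0_left)
      qed
      then have "\<forall>b\<in>S. c b = 0"
        using S(2) gf3_independent_iff[OF finS] by blast
      with nz \<open>c b = 0\<close> show False by auto
    qed
    \<comment> \<open>Pairing \<open>f\<close> with the dependency kills every block of
      \<open>S\<close> and leaves \<open>c b * sum f b = 0\<close>.\<close>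
    have "0 = (\<Sum>x\<in>{1..v}. f x * (\<Sum>b\<in>insert b S. c b * of_bool (x \<in> b)))"
      by (intro sum.neutral[symmetric] ballI) (simp only: c mult_zero_right)
    also have "\<dots> = (\<Sum>x\<in>{1..v}. \<Sum>b\<in>insert b S. c b * (f x * of_bool (x \<in> b)))"
      by (simp only: sum_distrib_left mult.left_commute)
    also have "\<dots> = (\<Sum>b\<in>insert b S. c b * (\<Sum>x\<in>{1..v}. f x * of_bool (x \<in> b)))"
      by (subst sum.swap) (simp only: sum_distrib_left)
    also have "\<dots> = (\<Sum>b\<in>insert b S. c b * sum f b)"
      by (rule sum.cong[OF refl], subst sum_restrict_of_bool) (use B S(1) b in auto)
    also have "\<dots> = c b * sum f b + (\<Sum>b\<in>S. c b * sum f b)"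
      by (rule sum.insert[OF finS False])
    also have "(\<Sum>b\<in>S. c b * sum f b) = 0"
      by (rule sum.neutral) (use f in \<open>simp add: homs_def\<close>)
    finally show ?thesis
      using cb by (simp add: mult_3_eq_0)
  qed
  then have "dual {1..v} S \<subseteq> dual {1..v} B"
    unfolding homs_def by blast
  moreover have "dual {1..v} B \<subseteq> dual {1..v} S"
    using S(1) unfolding homs_def by blast
  ultimately have "dual {1..v} S = dual {1..v} B"
    by (rule subset_antisym)
  moreover have "card (dual {1..v} S) * 3 ^ card S = 3 ^ v"
    by (rule card_dual_independent) (use S B in auto)
  ultimately show ?thesis
    using S(3) by simp
qed

section \<open>Homomorphisms from a Steiner triple system to a ternary space\<close>

text \<open>\<open>is_STS\<close> for an arbitrary point set: the fibres of a homomorphism have to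
  carry systems as well.\<close>

definition STS_on :: "'a set \<Rightarrow> 'a set set \<Rightarrow> bool" where
  "STS_on X B \<longleftrightarrow>
     (\<forall>b\<in>B. b \<subseteq> X \<and> card b = 3) \<and>
     (\<forall>p. p \<subseteq> X \<and> card p = 2 \<longrightarrow> (\<exists>!b. b \<in> B \<and> p \<subseteq> b))"

lemma is_STS_eq_STS_on: "is_STS v = STS_on {1..v}"
  by (simp add: fun_eq_iff is_STS_def STS_on_def)

lemma STS_on_block:
  assumes "STS_on X B" "b \<in> B"
  shows "b \<subseteq> X" "card b = 3" "finite b"
proof -
  show "b \<subseteq> X" and c: "card b = 3"
    using assms by (auto simp: STS_on_def)
  show "finite b"
    by (rule card_ge_0_finite) (simp add: c)
qed

lemma STS_on_pair:
  assumes "STS_on X B" "x \<in> X" "y \<in> X" "x \<noteq> y"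
  shows "\<exists>!b. b \<in> B \<and> {x, y} \<subseteq> b"
proof -
  have "{x, y} \<subseteq> X \<and> card {x, y} = 2"
    using assms by simp
  then show ?thesis
    using assms(1)[unfolded STS_on_def, THEN conjunct2, THEN spec, of "{x, y}"] by (rule rev_mp)
qed

lemma STS_on_third:
  assumes "STS_on X B" "x \<in> X" "y \<in> X" "x \<noteq> y"
  obtains z where "z \<in> X" "z \<noteq> x" "z \<noteq> y" "{x, y, z} \<in> B"
proof -
  obtain b where b: "b \<in> B" "x \<in> b" "y \<in> b"
    using STS_on_pair[OF assms] by auto
  note bl = STS_on_block[OF assms(1) b(1)]
  have "card (b - {x, y}) = 1"
    using bl b assms(4) by (simp add: card_Diff_subset)
  then obtain z where z: "b - {x, y} = {z}"
    by (auto simp: card_1_singleton_iff)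
  then have "b = {x, y, z}" using b by auto
  then show ?thesis
    using that[of z] z b bl by auto
qed

lemma STS_on_unique:
  assumes "STS_on X B" "b \<in> B" "b' \<in> B" "x \<in> b" "y \<in> b" "x \<in> b'" "y \<in> b'" "x \<noteq> y"
  shows "b = b'"
proof -
  have "\<exists>!b. b \<in> B \<and> {x, y} \<subseteq> b"
    by (rule STS_on_pair[OF assms(1)]) (use assms(4,5,8) STS_on_block(1)[OF assms(1,2)] in auto)
  moreover have "{x, y} \<subseteq> b" "{x, y} \<subseteq> b'"
    using assms(4-7) by auto
  ultimately show ?thesis
    using assms(2,3) by (metis (no_types))
qed

lemma STS_on_finite: "finite X \<Longrightarrow> finite {B. STS_on X B}"
  by (rule finite_subset[of _ "Pow (Pow X)"]) (auto simp: STS_on_def)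

lemma sum_triple:
  "x \<noteq> y \<Longrightarrow> z \<noteq> x \<Longrightarrow> z \<noteq> y \<Longrightarrow> (\<Sum>u\<in>{x, y, z}. f u) = f x + f y + (f z :: 'b :: comm_monoid_add)"
  by (simp add: add.assoc)

lemma homs_block:
  fixes f :: "'a \<Rightarrow> 'g::ab_group_add"
  assumes "f \<in> homs X B G" "{x, y, z} \<in> B" "x \<noteq> y" "z \<noteq> x" "z \<noteq> y"
  shows "f z = - (f x + f y)"
proof -
  have "(\<Sum>u\<in>{x, y, z}. f u) = 0"
    using assms(1,2) unfolding homs_def by blast
  then have "f x + f y + f z = 0"
    by (simp only: sum_triple[OF assms(3-5)])
  then show ?thesis
    by (rule minus_unique[symmetric])
qed

text \<open>Only the completion of a line by its third point \<open>- (a + b)\<close> and exponent 3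
  are kept, so that GF(3) itself and every \<open>coords j\<close> are instances.\<close>

locale ternary_space =
  fixes V :: "'g::ab_group_add set"
  assumes closed: "a \<in> V \<Longrightarrow> b \<in> V \<Longrightarrow> - (a + b) \<in> V"
    and triple: "a \<in> V \<Longrightarrow> a + a + a = 0"
    and finite_V: "finite V"
begin

lemma neg_double: "a \<in> V \<Longrightarrow> - (a + a) = a"
  by (rule minus_unique) (rule triple)

text \<open>By exponent 3, \<open>a\<close> equals \<open>- (a + a)\<close>; hence
  \<open>- (a + b) = a\<close> would give \<open>b = a\<close>.\<close>

lemma line_distinct: "a \<in> V \<Longrightarrow> b \<in> V \<Longrightarrow> a \<noteq> b \<Longrightarrow> - (a + b) \<noteq> a"
  using neg_double[of a] by (metis add_left_cancel neg_equal_iff_equal)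

lemma line_distinct': "a \<in> V \<Longrightarrow> b \<in> V \<Longrightarrow> a \<noteq> b \<Longrightarrow> - (a + b) \<noteq> b"
  using line_distinct[of b a] by (simp add: add.commute)

lemma hom_third:
  assumes "STS_on X B" "f \<in> homs X B V" "x \<in> X" "y \<in> X" "x \<noteq> y"
  obtains z where "z \<in> X" "z \<noteq> x" "z \<noteq> y" "{x, y, z} \<in> B" "f z = - (f x + f y)"
proof -
  obtain z where z: "z \<in> X" "z \<noteq> x" "z \<noteq> y" "{x, y, z} \<in> B"
    using STS_on_third[OF assms(1,3,4,5)] .
  have "f z = - (f x + f y)"
    using homs_block[OF assms(2) z(4) assms(5) z(2,3)] .
  with z show ?thesis by (rule that)
qed

end

lemma homs_mem: "f \<in> homs X B V \<Longrightarrow> x \<in> X \<Longrightarrow> f x \<in> V"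
  by (auto simp: homs_def)

lemma ternary_space_3: "ternary_space (UNIV :: 3 set)"
  by standard (rule UNIV_I triple_3 finite_class.finite_UNIV)+

text \<open>Over GF(3) a map that respects the third point of every line is affine;
  \<open>affine_maps_add\<close> is the corresponding additivity on \<open>coords j\<close>.\<close>

definition affine_maps :: "'g::ab_group_add set \<Rightarrow> ('g \<Rightarrow> 3) set" where
  "affine_maps V = {h \<in> V \<rightarrow>\<^sub>E UNIV. \<forall>a\<in>V. \<forall>b\<in>V. h (- (a + b)) = - (h a + h b)}"

context ternary_space
begin

text \<open>Two points \<open>x\<close>, \<open>w\<close> in different fibres determine a third one; for fixed \<open>w\<close> this moves
  the fibre of \<open>x\<close> injectively into another fibre.\<close>

lemma fibre_le:
  assumes X: "finite X" and S: "STS_on X B" and f: "f \<in> homs X B V"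
    and a: "a \<in> f ` X" and b: "b \<in> f ` X"
  shows "card {x \<in> X. f x = a} \<le> card {x \<in> X. f x = b}"
proof (cases "a = b")
  case False
  obtain x y where xy: "x \<in> X" "y \<in> X" "f x = a" "f y = b"
    using a b by auto
  have V: "a \<in> V" "b \<in> V" using xy homs_mem[OF f] by auto
  obtain w where w: "w \<in> X" "f w = - (a + b)"
    using hom_third[OF S f xy(1,2)] xy False by metis
  have "\<exists>z. z \<in> X \<and> z \<noteq> w \<and> {u, w, z} \<in> B \<and> f z = b" if u: "u \<in> X" "f u = a" for u
  proof -
    have "u \<noteq> w" using line_distinct[OF V False] u w by auto
    from hom_third[OF S f u(1) w(1) this] obtain z where
      z: "z \<in> X" "z \<noteq> u" "z \<noteq> w" "{u, w, z} \<in> B" "f z = - (f u + f w)" .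
    have "f z = b" using z(5) u w by (simp add: algebra_simps)
    with z show ?thesis by blast
  qed
  then obtain t where t: "\<And>u. u \<in> X \<Longrightarrow> f u = a \<Longrightarrow> t u \<in> X \<and> t u \<noteq> w \<and> {u, w, t u} \<in> B \<and> f (t u) = b"
    by metis
  have "inj_on t {x \<in> X. f x = a}"
  proof (rule inj_onI)
    fix u u' assume *: "u \<in> {x \<in> X. f x = a}" "u' \<in> {x \<in> X. f x = a}" "t u = t u'"
    then have "{u, w, t u} = {u', w, t u'}"
      using t[of u] t[of u'] by (intro STS_on_unique[OF S, of _ _ w "t u"]) auto
    moreover have "u \<noteq> t u'" "u' \<noteq> t u" "u \<noteq> w"
      using * t[of u] t[of u'] False line_distinct[OF V False] w by auto
    ultimately show "u = u'" by auto
  qed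
  moreover have "t ` {x \<in> X. f x = a} \<subseteq> {x \<in> X. f x = b}"
    using t by auto
  ultimately show ?thesis
    using X by (intro card_inj_on_le) auto
qed simp

text \<open>\<open>fibre_le\<close> in both directions makes all fibres over \<open>V\<close>
  equally large.\<close>

lemma card_fibre:
  assumes X: "finite X" and S: "STS_on X B" and f: "f \<in> homs X B V"
    and sur: "f ` X = V" and a: "a \<in> V"
  shows "card {x \<in> X. f x = a} * card V = card X"
proof -
  have "card X = (\<Sum>b\<in>V. card {x \<in> X. f x = b})"
    using X finite_V sur by (subst card_eq_sum, subst sum.image_gen[OF X, of _ f]) auto
  also have "\<dots> = (\<Sum>b\<in>V. card {x \<in> X. f x = a})"
    using fibre_le[OF X S f] sur a by (intro sum.cong refl antisym) auto
  finally show ?thesis by (simp add: mult.commute)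
qed

text \<open>Two points of one fibre with different \<open>g\<close>-values are moved to the fibre
  over \<open>b\<close> by taking third points with a common \<open>w\<close>. Their values stay
  different, and the block through the two new points supplies the remaining value of GF(3).\<close>

lemma surj_extend_or_factor:
  assumes S: "STS_on X B" and f: "f \<in> homs X B V" and sur: "f ` X = V" and g: "g \<in> dual X B"
    and nf: "\<not> (\<forall>x\<in>X. \<forall>y\<in>X. f x = f y \<longrightarrow> g x = g y)" and b: "b \<in> V"
  shows "\<exists>x\<in>X. f x = b \<and> g x = t"
proof -
  interpret Z: ternary_space "UNIV :: 3 set" by (rule ternary_space_3)
  \<comment> \<open>In the degenerate case \<open>x = y\<close> the point itself serves, as
    \<open>- (a + a) = a\<close>.\<close>
  have third: "\<exists>z\<in>X. f z = - (f x + f y) \<and> g z = - (g x + g y)" if "x \<in> X" "y \<in> X" for x y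
  proof (cases "x = y")
    case True
    then show ?thesis
      using that neg_double[OF homs_mem[OF f]] Z.neg_double by (metis UNIV_I)
  next
    case False
    from hom_third[OF S f that this] obtain z where
      z: "z \<in> X" "z \<noteq> x" "z \<noteq> y" "{x, y, z} \<in> B" "f z = - (f x + f y)" .
    have "g z = - (g x + g y)"
      using homs_block[OF g z(4) False z(2,3)] .
    with z show ?thesis by blast
  qed
  obtain x y where xy: "x \<in> X" "y \<in> X" "f x = f y" "g x \<noteq> g y"
    using nf by blast
  \<comment> \<open>Chosen so that the third point of \<open>x\<close> and \<open>w\<close>, and
    likewise of \<open>y\<close> and \<open>w\<close>, lies over \<open>b\<close>.\<close>
  have "- (f x + b) \<in> V" using closed homs_mem[OF f] xy b by auto
  then obtain w where w: "w \<in> X" "f w = - (f x + b)" using sur by force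
  obtain x' where x': "x' \<in> X" "f x' = b" "g x' = - (g x + g w)"
    using third[OF xy(1) w(1)] w by auto
  obtain y' where y': "y' \<in> X" "f y' = b" "g y' = - (g y + g w)"
    using third[OF xy(2) w(1)] w xy by auto
  have ne: "g x' \<noteq> g y'" using x' y' xy by auto
  obtain z' where z': "z' \<in> X" "f z' = b" "g z' = - (g x' + g y')"
    using third[OF x'(1) y'(1)] x' y' neg_double[OF b] by auto
  have "card {g x', g y', g z'} = 3"
    using Z.line_distinct[OF _ _ ne] Z.line_distinct'[OF _ _ ne] ne z'(3) by auto
  then have "{g x', g y', g z'} = UNIV"
    by (intro card_subset_eq) auto
  then have "t \<in> {g x', g y', g z'}" by auto
  then show ?thesis using x' y' z' by auto
qed

text \<open>Composition with \<open>f\<close> is a bijection from the affine maps: it is injective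
  because \<open>f\<close> is onto \<open>V\<close>, and a dual word that is constant on the fibres
  descends along \<open>f\<close>.\<close>

lemma card_factoring:
  assumes S: "STS_on X B" and f: "f \<in> homs X B V" and sur: "f ` X = V"
  shows "card {g \<in> dual X B. \<forall>x\<in>X. \<forall>y\<in>X. f x = f y \<longrightarrow> g x = g y} = card (affine_maps V)"
    (is "card ?G = _")
proof -
  interpret Z: ternary_space "UNIV :: 3 set" by (rule ternary_space_3)
  let ?c = "\<lambda>h. \<lambda>x\<in>X. h (f x)"
  have inj: "inj_on ?c (affine_maps V)"
  proof (rule inj_onI)
    fix h h' assume *: "h \<in> affine_maps V" "h' \<in> affine_maps V" "?c h = ?c h'"
    show "h = h'"
    proof (rule PiE_ext[of h V "\<lambda>_. UNIV"])
      fix a assume "a \<in> V"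
      then obtain x where "x \<in> X" "a = f x" using sur by auto
      then show "h a = h' a" using fun_cong[OF *(3), of x] by simp
    qed (use * in \<open>auto simp: affine_maps_def\<close>)
  qed
  have "?c h \<in> ?G" if h: "h \<in> affine_maps V" for h
  proof -
    have "(\<Sum>x\<in>b. ?c h x) = 0" if b: "b \<in> B" for b
    proof -
      note bl = STS_on_block[OF S b]
      obtain x y z where xyz: "b = {x, y, z}" "x \<noteq> y" "z \<noteq> x" "z \<noteq> y"
        using bl(2) by (auto simp: card_3_iff)
      have "f z = - (f x + f y)"
        using homs_block[OF f] b xyz by simp
      then have "h (f z) = - (h (f x) + h (f y))"
        using h homs_mem[OF f] xyz bl(1) by (auto simp: affine_maps_def)
      then show ?thesis
        using xyz bl(1) by (simp add: sum_triple)
    qed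
    then show ?thesis by (auto simp: homs_def)
  qed
  moreover have "g \<in> ?c ` affine_maps V" if g: "g \<in> ?G" for g
  proof -
    \<comment> \<open>Any section of \<open>f\<close> gives the same \<open>h0\<close> on
      \<open>V\<close>, since \<open>g\<close> is constant on each fibre.\<close>
    define h0 where "h0 a = g (inv_into X f a)" for a
    have h0: "g x = h0 (f x)" if "x \<in> X" for x
    proof -
      have "inv_into X f (f x) \<in> X" "f (inv_into X f (f x)) = f x"
        using that by (auto intro: inv_into_into f_inv_into_f)
      with g that show ?thesis
        unfolding h0_def by (metis (mono_tags, lifting) mem_Collect_eq)
    qed
    define h where "h = restrict h0 V"
    have h: "h (f x) = g x" if "x \<in> X" for x
      using that h0 homs_mem[OF f] by (simp add: h_def)
    have "h (- (f x + f y)) = - (h (f x) + h (f y))" if xy: "x \<in> X" "y \<in> X" for x y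
    proof (cases "x = y")
      case True
      then show ?thesis
        using neg_double[OF homs_mem[OF f xy(1)]] Z.neg_double[of "h (f x)"] by simp
    next
      case False
      from hom_third[OF S f xy this] obtain z where
        z: "z \<in> X" "z \<noteq> x" "z \<noteq> y" "{x, y, z} \<in> B" "f z = - (f x + f y)" .
      have "g z = - (g x + g y)"
        using homs_block[OF _ z(4) False z(2,3)] g by blast
      then show ?thesis using h xy z by metis
    qed
    then have "\<forall>a\<in>f ` X. \<forall>b\<in>f ` X. h (- (a + b)) = - (h a + h b)"
      by blast
    moreover have "h \<in> V \<rightarrow>\<^sub>E UNIV"
      by (simp add: h_def)
    ultimately have "h \<in> affine_maps V"
      unfolding affine_maps_def sur by blast
    moreover have "g = ?c h"
    proof (rule extensionalityI[of _ X])
      show "g \<in> extensional X" using g by (auto simp: homs_def PiE_def)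
    qed (use h in auto)
    ultimately show ?thesis by blast
  qed
  ultimately have "?c ` affine_maps V = ?G" by blast
  then show ?thesis
    using card_image[OF inj] by simp
qed

end

section \<open>Affine maps on coordinate spaces\<close>

text \<open>\<open>GF(3)\<^sup>j\<close> is encoded by the sequences over \<open>GF(3)\<close> that vanish from index \<open>j\<close> on.\<close>

definition coords :: "nat \<Rightarrow> (nat \<Rightarrow> 3) set"
  where "coords j = {a. \<forall>n\<ge>j. a n = 0}"

lemma coords_0: "coords 0 = {0}"
  by (auto simp: coords_def fun_eq_iff)

lemma coords_upd: "a \<in> coords j \<Longrightarrow> a(j := t) \<in> coords (Suc j)"
  by (auto simp: coords_def)

lemma coords_upd_0: "a \<in> coords (Suc j) \<Longrightarrow> a(j := 0) \<in> coords j"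
  by (auto simp: coords_def not_less_eq_eq)

lemma coords_last: "a \<in> coords j \<Longrightarrow> a j = 0"
  by (auto simp: coords_def)

lemma coords_mono: "a \<in> coords j \<Longrightarrow> a \<in> coords (Suc j)"
  by (auto simp: coords_def)

lemma bij_coords: "bij_betw (\<lambda>(a, t). a(j := t)) (coords j \<times> UNIV) (coords (Suc j))"
  by (rule bij_betw_byWitness[where f' = "\<lambda>a. (a(j := 0), a j)"])
    (auto simp: coords_upd coords_upd_0 coords_last fun_eq_iff split: if_splits)

lemma card_coords: "card (coords j) = 3 ^ j"
proof (induction j)
  case (Suc j)
  show ?case
    using bij_betw_same_card[OF bij_coords[of j]] Suc by (simp add: card_cartesian_product)
qed (simp add: coords_0)

lemma ternary_space_coords: "ternary_space (coords j)"
proof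
  show "finite (coords j)"
    by (rule card_ge_0_finite) (simp add: card_coords)
  show "- (a + b) \<in> coords j" if "a \<in> coords j" "b \<in> coords j" for a b
    using that by (simp add: coords_def)
  show "a + a + a = 0" for a :: "nat \<Rightarrow> 3"
    by (rule ext) (simp only: plus_fun_apply zero_fun_apply triple_3)
qed

text \<open>The third point of \<open>a\<close> and \<open>b\<close> is also the third point of
  \<open>a + b\<close> and \<open>0\<close>; comparing the two expressions for \<open>h\<close>
  there gives additivity up to the constant \<open>h 0\<close>.\<close>

lemma affine_maps_add:
  fixes h :: "(nat \<Rightarrow> 3) \<Rightarrow> 3"
  assumes h: "h \<in> affine_maps (coords j)" and a: "a \<in> coords j" and b: "b \<in> coords j"
  shows "h (a + b) = h a + h b - h 0"
proof -
  have z: "0 \<in> coords j" by (simp add: coords_def)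
  have neg: "- c \<in> coords j" if "c \<in> coords j" for c using that by (simp add: coords_def)
  have plus: "a + b \<in> coords j" using a b by (simp add: coords_def)
  have *: "h (- (c + d)) = - (h c + h d)" if "c \<in> coords j" "d \<in> coords j" for c d
    using h that by (simp add: affine_maps_def)
  have "h (- (a + b)) = - h (a + b) - h 0"
    using *[OF plus z] by simp
  moreover have "h (- (a + b)) = - (h a + h b)"
    by (rule *[OF a b])
  ultimately have "- h (a + b) - h 0 = - (h a + h b)"
    by (rule trans[OF sym])
  from arg_cong[OF this, of uminus] show ?thesis
    by (simp add: algebra_simps)
qed

definition unit_coord :: "nat \<Rightarrow> nat \<Rightarrow> 3"
  where "unit_coord j = (\<lambda>n. if n = j then 1 else 0)"

lemma unit_coord: "unit_coord j \<in> coords (Suc j)"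
  by (auto simp: unit_coord_def coords_def)

text \<open>The last coordinate is 0, 1 or 2, so \<open>a\<close> arises from
  \<open>a(j := 0)\<close> by adding the unit vector that many times; each addition changes
  \<open>h\<close> by the slope \<open>h (unit_coord j) - h 0\<close>.\<close>

lemma affine_maps_last:
  assumes h: "h \<in> affine_maps (coords (Suc j))" and a: "a \<in> coords (Suc j)"
  shows "h a = h (a(j := 0)) + a j * (h (unit_coord j) - h 0)"
proof -
  let ?e = "unit_coord j"
  have a0: "a(j := 0) \<in> coords (Suc j)" by (rule coords_mono[OF coords_upd_0[OF a]])
  have e: "?e \<in> coords (Suc j)" by (rule unit_coord)
  have 1: "h (a(j := 0) + ?e) = h (a(j := 0)) + h ?e - h 0"
    by (rule affine_maps_add[OF h a0 e])
  have "a(j := 0) + ?e \<in> coords (Suc j)" using a0 e by (simp add: coords_def)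
  then have 2: "h (a(j := 0) + ?e + ?e) = h (a(j := 0)) + h ?e - h 0 + h ?e - h 0"
    using affine_maps_add[OF h _ e, of "a(j := 0) + ?e"] by (simp only: 1)
  show ?thesis
  proof (cases "a j" rule: cases_3)
    case 1
    then have "a(j := 0) = a" by auto
    with 1 show ?thesis by simp
  next
    case 2
    then have "a(j := 0) + ?e = a" by (auto simp: unit_coord_def fun_eq_iff)
    with 1 2 show ?thesis by simp
  next
    case 3
    then have "a(j := 0) + ?e + ?e = a" by (auto simp: unit_coord_def fun_eq_iff)
    with 2 3 show ?thesis by (simp add: algebra_simps)
  qed
qed

text \<open>Each coordinate contributes one free slope; the additional factor 3 is the constant
  term, which is all there is on \<open>coords 0\<close>. The inverse \<open>?g\<close> reads the
  slope off at the unit vector.\<close>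

lemma card_affine_maps: "card (affine_maps (coords j)) = 3 ^ (j + 1)"
proof (induction j)
  case 0
  have "- (h 0 + h 0) = h 0" for h :: "(nat \<Rightarrow> 3) \<Rightarrow> 3"
    using ternary_space.neg_double[OF ternary_space_3] by simp
  then have "affine_maps (coords 0) = {0} \<rightarrow>\<^sub>E UNIV"
    unfolding affine_maps_def coords_0 by simp
  then show ?case
    by (simp add: card_PiE)
next
  case (Suc j)
  let ?e = "unit_coord j"
  let ?f = "\<lambda>(h, s). \<lambda>a\<in>coords (Suc j). h (a(j := 0)) + a j * s"
  let ?g = "\<lambda>h. (restrict h (coords j), h ?e - h 0)"
  have z: "0 \<in> coords i" for i by (simp add: coords_def)
  have "bij_betw ?f (affine_maps (coords j) \<times> UNIV) (affine_maps (coords (Suc j)))"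
  proof (rule bij_betw_byWitness[where f' = ?g])
    show "\<forall>p\<in>affine_maps (coords j) \<times> UNIV. ?g (?f p) = p"
    proof
      fix p :: "((nat \<Rightarrow> 3) \<Rightarrow> 3) \<times> 3"
      assume "p \<in> affine_maps (coords j) \<times> UNIV"
      then obtain h s where p: "p = (h, s)" and h: "h \<in> affine_maps (coords j)"
        by auto
      have 1: "restrict (?f (h, s)) (coords j) = h"
      proof (rule extensionalityI[of _ "coords j"])
        show "h \<in> extensional (coords j)" using h by (auto simp: affine_maps_def PiE_def)
        fix a assume a: "a \<in> coords j"
        then have "a(j := 0) = a" by (auto simp: coords_last)
        with a show "restrict (?f (h, s)) (coords j) a = h a"
          by (simp add: coords_mono coords_last)
      qed (simp add: extensional_def)
      have 2: "?f (h, s) ?e - ?f (h, s) 0 = s"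
      proof -
        have "?e(j := 0) = 0" "0(j := 0) = (0 :: nat \<Rightarrow> 3)" "?e j = 1"
          by (auto simp: unit_coord_def fun_eq_iff)
        then show ?thesis by (simp add: unit_coord z)
      qed
      show "?g (?f p) = p"
        unfolding p by (simp only: 1 2)
    qed
    show "\<forall>h\<in>affine_maps (coords (Suc j)). ?f (?g h) = h"
    proof
      fix h :: "(nat \<Rightarrow> 3) \<Rightarrow> 3"
      assume h: "h \<in> affine_maps (coords (Suc j))"
      show "?f (?g h) = h"
      proof (rule extensionalityI[of _ "coords (Suc j)"])
        show "h \<in> extensional (coords (Suc j))" using h by (auto simp: affine_maps_def PiE_def)
        fix a assume a: "a \<in> coords (Suc j)"
        show "?f (?g h) a = h a"
          using affine_maps_last[OF h a] a by (simp add: coords_upd_0)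
      qed simp
    qed
    show "?f ` (affine_maps (coords j) \<times> UNIV) \<subseteq> affine_maps (coords (Suc j))"
    proof (rule image_subsetI)
      fix p :: "((nat \<Rightarrow> 3) \<Rightarrow> 3) \<times> 3"
      assume "p \<in> affine_maps (coords j) \<times> UNIV"
      then obtain h s where p: "p = (h, s)" and h: "h \<in> affine_maps (coords j)"
        by auto
      have "?f (h, s) (- (a + b)) = - (?f (h, s) a + ?f (h, s) b)"
        if ab: "a \<in> coords (Suc j)" "b \<in> coords (Suc j)" for a b
      proof -
        have m: "- (a + b) \<in> coords (Suc j)" using ab by (simp add: coords_def)
        have eq: "(- (a + b))(j := 0) = - (a(j := 0) + b(j := 0))"
          by (rule ext) simp
        have "h (- (a(j := 0) + b(j := 0))) = - (h (a(j := 0)) + h (b(j := 0)))"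
          using h ab by (simp add: affine_maps_def coords_upd_0)
        then show ?thesis
          using m ab by (simp only: eq split restrict_apply) (simp add: algebra_simps)
      qed
      then show "?f p \<in> affine_maps (coords (Suc j))"
        unfolding affine_maps_def p by simp
    qed
    show "?g ` affine_maps (coords (Suc j)) \<subseteq> affine_maps (coords j) \<times> UNIV"
    proof (rule image_subsetI)
      fix h :: "(nat \<Rightarrow> 3) \<Rightarrow> 3"
      assume h: "h \<in> affine_maps (coords (Suc j))"
      have "h (- (a + b)) = - (h a + h b)" "- (a + b) \<in> coords j"
        if "a \<in> coords j" "b \<in> coords j" for a b
      proof -
        show "h (- (a + b)) = - (h a + h b)"
          using h coords_mono[OF that(1)] coords_mono[OF that(2)] unfolding affine_maps_def by blast
        show "- (a + b) \<in> coords j"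
          using that by (simp add: coords_def)
      qed
      then have "restrict h (coords j) \<in> affine_maps (coords j)"
        unfolding affine_maps_def by simp
      then show "?g h \<in> affine_maps (coords j) \<times> UNIV"
        by simp
    qed
  qed
  from bij_betw_same_card[OF this] Suc show ?case
    by (simp add: card_cartesian_product)
qed

section \<open>Homomorphisms onto coordinate spaces\<close>

definition surj_homs :: "'a set \<Rightarrow> 'a set set \<Rightarrow> nat \<Rightarrow> ('a \<Rightarrow> nat \<Rightarrow> 3) set"
  where "surj_homs X B j = {f \<in> homs X B (coords j). f ` X = coords j}"

lemma sum_fun_apply: "(\<Sum>x\<in>A. f x) n = (\<Sum>x\<in>A. f x n)"
  for f :: "'a \<Rightarrow> 'b \<Rightarrow> 'c::comm_monoid_add"
  by (induction A rule: infinite_finite_induct) auto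

lemma finite_homs: "finite X \<Longrightarrow> finite G \<Longrightarrow> finite (homs X B G)"
  by (rule finite_subset[of _ "X \<rightarrow>\<^sub>E G"]) (auto simp: homs_def intro: finite_PiE)

lemma card_surj_homs_0:
  assumes "X \<noteq> {}" and S: "STS_on X B"
  shows "card (surj_homs X B 0) = 1"
proof -
  have "surj_homs X B 0 = {restrict (\<lambda>_. 0) X}"
  proof (intro equalityI subsetI)
    fix f assume "f \<in> surj_homs X B 0"
    then have "f \<in> X \<rightarrow>\<^sub>E {0}" by (simp add: surj_homs_def homs_def coords_0)
    then show "f \<in> {restrict (\<lambda>_. 0) X}"
      by (auto simp: fun_eq_iff PiE_iff extensional_def)
  next
    fix f assume f: "f \<in> {restrict (\<lambda>_. 0 :: nat \<Rightarrow> 3) X}"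
    then have "\<forall>b\<in>B. (\<Sum>x\<in>b. f x) = 0"
      using STS_on_block(1)[OF S] by (intro ballI sum.neutral) auto
    then show "f \<in> surj_homs X B 0"
      using assms f unfolding surj_homs_def homs_def coords_0 by auto
  qed
  then show ?thesis by simp
qed

section \<open>Counting surjective homomorphisms\<close>

lemma homs_restrict_iff:
  assumes "STS_on X B"
  shows "restrict f X \<in> homs X B G \<longleftrightarrow> f ` X \<subseteq> G \<and> (\<forall>b\<in>B. (\<Sum>x\<in>b. f x) = 0)"
proof -
  have "(\<Sum>x\<in>b. restrict f X x) = (\<Sum>x\<in>b. f x)" if "b \<in> B" for b
    using STS_on_block(1)[OF assms that] by (intro sum.cong) auto
  then show ?thesis
    by (auto simp: homs_def)
qed

text \<open>A map onto \<open>coords (Suc j)\<close> is a map \<open>f\<close> onto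
  \<open>coords j\<close> together with a last coordinate \<open>g\<close> that is not a function of
  \<open>f\<close>; the words that are functions of \<open>f\<close> number
  \<open>3 ^ (j + 1)\<close>. The difference is taken in \<open>int\<close> because it may be
  negative, though only when there is no map onto \<open>coords j\<close>.\<close>

lemma card_surj_homs_Suc:
  assumes X: "finite X" "X \<noteq> {}" and S: "STS_on X B"
  shows "int (card (surj_homs X B (Suc j))) =
    int (card (surj_homs X B j)) * (int (card (dual X B)) - 3 ^ (j + 1))"
proof -
  let ?V = "coords j"
  interpret ternary_space ?V by (rule ternary_space_coords)
  define fac where "fac = (\<lambda>(f :: 'a \<Rightarrow> nat \<Rightarrow> 3) (g :: 'a \<Rightarrow> 3). \<forall>x\<in>X. \<forall>y\<in>X. f x = f y \<longrightarrow> g x = g y)"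
  define P where "P = (SIGMA f : surj_homs X B j. {g \<in> dual X B. \<not> fac f g})"
  let ?join = "\<lambda>(f, g). \<lambda>x\<in>X. (f x)(j := g x :: 3)"
  let ?split = "\<lambda>F. (\<lambda>x\<in>X. (F x)(j := 0 :: 3), \<lambda>x\<in>X. F x j)"
  have zero_iff: "(\<Sum>x\<in>b. F x) = 0 \<longleftrightarrow> (\<forall>n. (\<Sum>x\<in>b. F x n) = 0)" for F :: "'a \<Rightarrow> nat \<Rightarrow> 3" and b
    by (simp add: fun_eq_iff sum_fun_apply)
  have "bij_betw ?join P (surj_homs X B (Suc j))"
  proof (rule bij_betw_byWitness[where f' = ?split])
    show "\<forall>p\<in>P. ?split (?join p) = p"
    proof
      fix p assume "p \<in> P"
      then obtain f g where p: "p = (f, g)" and f: "f \<in> homs X B ?V" and g: "g \<in> dual X B"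
        by (auto simp: P_def surj_homs_def)
      have "(\<lambda>x\<in>X. (?join p x)(j := 0)) = f"
      proof (rule extensionalityI[of _ X])
        show "f \<in> extensional X" using f by (auto simp: homs_def PiE_def)
        show "(\<lambda>x\<in>X. (?join p x)(j := 0)) x = f x" if "x \<in> X" for x
          using that coords_last[OF homs_mem[OF f that]] by (simp add: p fun_upd_idem)
      qed simp
      moreover have "(\<lambda>x\<in>X. ?join p x j) = g"
      proof (rule extensionalityI[of _ X])
        show "g \<in> extensional X" using g by (auto simp: homs_def PiE_def)
      qed (auto simp: p)
      ultimately show "?split (?join p) = p"
        unfolding p by blast
    qed
    show "\<forall>F\<in>surj_homs X B (Suc j). ?join (?split F) = F"
    proof
      fix F assume "F \<in> surj_homs X B (Suc j)"
      then have "F \<in> extensional X" by (auto simp: surj_homs_def homs_def PiE_def)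
      then show "?join (?split F) = F"
        by (intro extensionalityI[of _ X]) auto
    qed
    show "?join ` P \<subseteq> surj_homs X B (Suc j)"
    proof (rule image_subsetI)
      fix p assume "p \<in> P"
      then obtain f g where p: "p = (f, g)" and f: "f \<in> homs X B ?V" and sur: "f ` X = ?V"
        and g: "g \<in> dual X B" and nf: "\<not> fac f g"
        by (auto simp: P_def surj_homs_def)
      let ?F = "\<lambda>x. (f x)(j := g x)"
      have im: "?F ` X \<subseteq> coords (Suc j)"
        using homs_mem[OF f] by (auto intro: coords_upd)
      have "(\<Sum>x\<in>b. ?F x) = 0" if b: "b \<in> B" for b
      proof -
        have "(\<Sum>x\<in>b. f x n) = 0" for n
          using f b zero_iff[of f b] by (auto simp: homs_def)
        moreover have "(\<Sum>x\<in>b. g x) = 0" using g b by (auto simp: homs_def)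
        ultimately have "(\<Sum>x\<in>b. ?F x n) = 0" for n
          by (cases "n = j") simp_all
        then show ?thesis unfolding zero_iff by blast
      qed
      then have 1: "restrict ?F X \<in> homs X B (coords (Suc j))"
        using im by (simp add: homs_restrict_iff[OF S])
      \<comment> \<open>Here it matters that \<open>g\<close> does not factor: over every point of
        \<open>coords j\<close> it takes all three values.\<close>
      have "coords (Suc j) \<subseteq> ?F ` X"
      proof
        fix a assume a: "a \<in> coords (Suc j)"
        obtain x where x: "x \<in> X" "f x = a(j := 0)" "g x = a j"
          using surj_extend_or_factor[OF S f sur g _ coords_upd_0[OF a], of "a j"] nf
          unfolding fac_def by blast
        have "?F x = a" using x by simp
        then show "a \<in> ?F ` X" using x(1) by (rule image_eqI[OF sym])
      qed
      then have "restrict ?F X ` X = coords (Suc j)" using im by auto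
      with 1 show "?join p \<in> surj_homs X B (Suc j)"
        unfolding surj_homs_def p by simp
    qed
    show "?split ` surj_homs X B (Suc j) \<subseteq> P"
    proof (rule image_subsetI)
      fix F assume F: "F \<in> surj_homs X B (Suc j)"
      then have Fh: "F \<in> homs X B (coords (Suc j))" and sur: "F ` X = coords (Suc j)"
        by (auto simp: surj_homs_def)
      let ?f = "\<lambda>x. (F x)(j := 0)"
      have im: "?f ` X \<subseteq> ?V"
        using homs_mem[OF Fh] by (auto intro: coords_upd_0)
      have z: "\<forall>n. (\<Sum>x\<in>b. F x n) = 0" if "b \<in> B" for b
        using Fh that zero_iff[of F b] by (auto simp: homs_def)
      have "(\<Sum>x\<in>b. ?f x n) = 0" if "b \<in> B" for b n
        using z[OF that] by (cases "n = j") simp_all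
      then have 1: "restrict ?f X \<in> homs X B ?V" "(\<lambda>x\<in>X. F x j) \<in> dual X B"
        unfolding homs_restrict_iff[OF S] zero_iff using im z by blast+
      have "a \<in> ?f ` X" if a: "a \<in> ?V" for a
      proof -
        obtain x where "x \<in> X" "F x = a" using sur coords_mono[OF a] by (metis imageE)
        then show ?thesis using coords_last[OF a] by (intro image_eqI[of _ _ x]) auto
      qed
      then have 2: "restrict ?f X ` X = ?V" using im by auto
      \<comment> \<open>The points \<open>0\<close> and \<open>unit_coord j\<close> agree in the
        coordinates below \<open>j\<close> and are both attained, so the last coordinate cannot
        factor.\<close>
      have "\<not> fac (restrict ?f X) (\<lambda>x\<in>X. F x j)"
      proof -
        have "0 \<in> coords (Suc j)" by (simp add: coords_def)
        then obtain x y where xy: "x \<in> X" "F x = 0" "y \<in> X" "F y = unit_coord j"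
          using sur unit_coord[of j] by (metis imageE)
        moreover have "(F x)(j := 0) = (F y)(j := 0)" "F x j \<noteq> F y j"
          unfolding xy by (auto simp: unit_coord_def)
        ultimately show ?thesis unfolding fac_def by force
      qed
      with 1 2 show "?split F \<in> P"
        unfolding P_def surj_homs_def by simp
    qed
  qed
  then have "card (surj_homs X B (Suc j)) = card P"
    by (rule bij_betw_same_card[symmetric])
  also have "\<dots> = (\<Sum>f\<in>surj_homs X B j. card {g \<in> dual X B. \<not> fac f g})"
    unfolding P_def using X(1) finite_V
    by (intro card_SigmaI) (simp_all add: surj_homs_def finite_homs)
  finally have "int (card (surj_homs X B (Suc j))) =
      (\<Sum>f\<in>surj_homs X B j. int (card {g \<in> dual X B. \<not> fac f g}))"
    by simp
  also have "\<dots> = (\<Sum>f\<in>surj_homs X B j. int (card (dual X B)) - 3 ^ (j + 1))"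
  proof (rule sum.cong[OF refl])
    fix f assume f: "f \<in> surj_homs X B j"
    have "card {g \<in> dual X B. fac f g} = 3 ^ (j + 1)"
      using card_factoring[OF S, of f] f card_affine_maps[of j]
      unfolding surj_homs_def fac_def by simp
    moreover have "finite (dual X B)"
      by (rule finite_homs[OF X(1)]) simp
    then have "card (dual X B) = card {g \<in> dual X B. fac f g} + card {g \<in> dual X B. \<not> fac f g}"
      by (subst card_Un_disjoint[symmetric]) (auto intro: arg_cong[where f = card])
    ultimately show "int (card {g \<in> dual X B. \<not> fac f g}) = int (card (dual X B)) - 3 ^ (j + 1)"
      by simp
  qed
  finally show ?thesis by simp
qed

lemma card_surj_homs:
  assumes X: "finite X" "X \<noteq> {}" and S: "STS_on X B"
  shows "int (card (surj_homs X B j)) = (\<Prod>t<j. int (card (dual X B)) - 3 ^ (t + 1))"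
  by (induction j) (simp_all only: card_surj_homs_Suc[OF assms] card_surj_homs_0[OF X(2) S], simp_all)

section \<open>Equidistributed maps and lines\<close>

definition equidistributed :: "'a set \<Rightarrow> 'b set \<Rightarrow> nat \<Rightarrow> ('a \<Rightarrow> 'b) set"
  where "equidistributed X V u = {f \<in> X \<rightarrow>\<^sub>E V. \<forall>a\<in>V. card {x \<in> X. f x = a} = u}"

lemma finite_equidistributed:
  assumes "finite X" "finite V"
  shows "finite (equidistributed X V u)"
proof (rule finite_subset)
  show "equidistributed X V u \<subseteq> X \<rightarrow>\<^sub>E V"
    unfolding equidistributed_def by blast
  show "finite (X \<rightarrow>\<^sub>E V)"
    using assms by (simp add: finite_PiE)
qed

text \<open>A multinomial coefficient, by induction on the target: the fibre over the new value is
  one of \<open>card X choose u\<close> subsets, and the remaining points are distributed over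
  \<open>V\<close>. Multiplying by the factorials avoids division.\<close>

lemma card_equidistributed:
  assumes "finite V" "finite X" "card X = card V * u"
  shows "card (equidistributed X V u) * fact u ^ card V = fact (card X)"
  using assms
proof (induction V arbitrary: X rule: finite_induct)
  case empty
  then show ?case by (simp add: equidistributed_def)
next
  case (insert a V)
  note X = insert.prems(1)
  have cX: "card X = u + card V * u"
    using insert.prems insert.hyps by simp
  let ?P = "SIGMA A : {A. A \<subseteq> X \<and> card A = u}. equidistributed (X - A) V u"
  let ?f = "\<lambda>(A, f). \<lambda>x\<in>X. if x \<in> A then a else f x"
  let ?g = "\<lambda>f. ({x \<in> X. f x = a}, restrict f {x \<in> X. f x \<noteq> a})"
  have "bij_betw ?f ?P (equidistributed X (insert a V) u)"
  proof (rule bij_betw_byWitness[where f' = ?g])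
    show "\<forall>p\<in>?P. ?g (?f p) = p"
    proof
      fix p assume "p \<in> ?P"
      then obtain A f where p: "p = (A, f)" and A: "A \<subseteq> X" and f: "f \<in> (X - A) \<rightarrow>\<^sub>E V"
        by (auto simp: equidistributed_def)
      have "{x \<in> X. ?f p x = a} = A"
        using A f insert.hyps(2) by (auto simp: p)
      moreover have "restrict (?f p) {x \<in> X. ?f p x \<noteq> a} = f"
      proof (rule extensionalityI[of _ "X - A"])
        show "f \<in> extensional (X - A)" using f by (simp add: PiE_def)
      qed (use f insert.hyps(2) in \<open>auto simp: p extensional_def\<close>)
      ultimately show "?g (?f p) = p"
        unfolding p by blast
    qed
    show "\<forall>f\<in>equidistributed X (insert a V) u. ?f (?g f) = f"
    proof
      fix f assume "f \<in> equidistributed X (insert a V) u"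
      then have "f \<in> extensional X" by (simp add: equidistributed_def PiE_def)
      then show "?f (?g f) = f"
        by (intro extensionalityI[of _ X]) auto
    qed
    show "?f ` ?P \<subseteq> equidistributed X (insert a V) u"
    proof (rule image_subsetI)
      fix p assume "p \<in> ?P"
      then obtain A f where p: "p = (A, f)" and A: "A \<subseteq> X" "card A = u"
        and f: "f \<in> (X - A) \<rightarrow>\<^sub>E V" and c: "\<And>b. b \<in> V \<Longrightarrow> card {x \<in> X - A. f x = b} = u"
        by (auto simp: equidistributed_def)
      have "{x \<in> X. ?f p x = a} = A"
        using A f insert.hyps(2) by (auto simp: p)
      moreover have "{x \<in> X. ?f p x = b} = {x \<in> X - A. f x = b}" if "b \<in> V" for b
        using that A insert.hyps(2) by (auto simp: p)
      moreover have "?f p \<in> X \<rightarrow>\<^sub>E insert a V"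
        using PiE_mem[OF f] by (auto simp: p)
      ultimately show "?f p \<in> equidistributed X (insert a V) u"
        unfolding equidistributed_def using A(2) c by auto
    qed
    show "?g ` equidistributed X (insert a V) u \<subseteq> ?P"
    proof (rule image_subsetI)
      fix f assume "f \<in> equidistributed X (insert a V) u"
      then have f: "f \<in> X \<rightarrow>\<^sub>E insert a V"
        and c: "\<And>b. b \<in> insert a V \<Longrightarrow> card {x \<in> X. f x = b} = u"
        by (auto simp: equidistributed_def)
      have D: "X - {x \<in> X. f x = a} = {x \<in> X. f x \<noteq> a}" by auto
      have "restrict f {x \<in> X. f x \<noteq> a} \<in> {x \<in> X. f x \<noteq> a} \<rightarrow>\<^sub>E V"
        using f by auto
      moreover have "card {x \<in> {x \<in> X. f x \<noteq> a}. restrict f {x \<in> X. f x \<noteq> a} x = b} = u"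
        if "b \<in> V" for b
      proof -
        have "{x \<in> {x \<in> X. f x \<noteq> a}. restrict f {x \<in> X. f x \<noteq> a} x = b} = {x \<in> X. f x = b}"
          using that insert.hyps(2) by auto
        then show ?thesis using c that by simp
      qed
      ultimately have "restrict f {x \<in> X. f x \<noteq> a} \<in> equidistributed {x \<in> X. f x \<noteq> a} V u"
        unfolding equidistributed_def by blast
      then show "?g f \<in> ?P"
        using c[of a] D by auto
    qed
  qed
  then have "card (equidistributed X (insert a V) u) = card ?P"
    by (rule bij_betw_same_card[symmetric])
  also have "\<dots> = (\<Sum>A\<in>{A. A \<subseteq> X \<and> card A = u}. card (equidistributed (X - A) V u))"
  proof (rule card_SigmaI)
    show "finite {A. A \<subseteq> X \<and> card A = u}" using X by simp
    show "\<forall>A\<in>{A. A \<subseteq> X \<and> card A = u}. finite (equidistributed (X - A) V u)"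
      using X insert.hyps(1) by (simp add: finite_equidistributed)
  qed
  finally have "card (equidistributed X (insert a V) u) * fact u ^ card V =
      (\<Sum>A\<in>{A. A \<subseteq> X \<and> card A = u}. card (equidistributed (X - A) V u) * fact u ^ card V)"
    by (simp add: sum_distrib_right)
  also have "\<dots> = (\<Sum>A\<in>{A. A \<subseteq> X \<and> card A = u}. fact (card X - u))"
  proof (rule sum.cong[OF refl])
    fix A assume A: "A \<in> {A. A \<subseteq> X \<and> card A = u}"
    then have "card (X - A) = card X - u"
      using X finite_subset by (subst card_Diff_subset) auto
    then show "card (equidistributed (X - A) V u) * fact u ^ card V = fact (card X - u)"
      using insert.IH[of "X - A"] X cX by simp
  qed
  also have "\<dots> = (card X choose u) * fact (card X - u)"
    using n_subsets[OF X] by simp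
  finally show ?case
    using binomial_fact_lemma[of u "card X"] cX insert.hyps by (simp add: mult_ac)
qed

section \<open>Affine lines over GF(3) as zero-sum triples\<close>

definition lines :: "'g::ab_group_add set \<Rightarrow> 'g set set"
  where "lines V = {l. l \<subseteq> V \<and> card l = 3 \<and> (\<Sum>a\<in>l. a) = 0}"

text \<open>In a ternary space this collapses to a single point for \<open>a = b\<close>, which lets
  fibres and lines be treated alike.\<close>

definition line_through :: "'g::ab_group_add \<Rightarrow> 'g \<Rightarrow> 'g set"
  where "line_through a b = {a, b, - (a + b)}"

text \<open>The zero sum determines the image of the third point from the other two, even when their
  images coincide.\<close>

lemma line_through_unique:
  fixes f :: "'a \<Rightarrow> 'g::ab_group_add"
  assumes "card b = 3" "(\<Sum>x\<in>b. f x) = 0" "x \<in> b" "y \<in> b" "x \<noteq> y"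
  shows "f ` b = line_through (f x) (f y)"
proof -
  have "card (b - {x, y}) = 1"
    using assms card_ge_0_finite[of b] by (simp add: card_Diff_subset)
  then obtain z where "b - {x, y} = {z}"
    by (auto simp: card_1_singleton_iff)
  then have z: "b = {x, y, z}" "z \<noteq> x" "z \<noteq> y" using assms by auto
  have "f x + f y + f z = 0"
    using assms(2) sum_triple[OF assms(5) z(2,3), of f] by (simp only: z(1))
  then have "- (f x + f y) = f z" by (rule minus_unique)
  then show ?thesis unfolding line_through_def z(1) by auto
qed

lemma finite_lines: "finite V \<Longrightarrow> finite (lines V)"
  by (rule finite_subset[of _ "Pow V"]) (auto simp: lines_def)

context ternary_space
begin

lemma line_through_eq:
  assumes "l \<in> lines V" "a \<in> l" "b \<in> l" "a \<noteq> b"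
  shows "line_through a b = l"
  using line_through_unique[of l "\<lambda>x. x" a b] assms by (simp add: lines_def)

lemma line_through_same: "a \<in> V \<Longrightarrow> line_through a a = {a}"
  unfolding line_through_def by (simp only: neg_double) simp

lemma line_through_in_lines:
  assumes "a \<in> V" "b \<in> V" "a \<noteq> b"
  shows "line_through a b \<in> lines V"
proof -
  note d = line_distinct[OF assms] line_distinct'[OF assms]
  have "(\<Sum>x\<in>line_through a b. x) = 0"
    unfolding line_through_def using sum_triple[OF assms(3) d, of "\<lambda>x. x"] by simp
  moreover have "card (line_through a b) = 3"
    unfolding line_through_def using d assms(3) by (auto simp: card_insert_if)
  ultimately show ?thesis
    using assms closed by (auto simp: lines_def line_through_def)
qed

text \<open>Double counting of ordered pairs of distinct points: each pair lies on one line, and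
  each line contains \<open>3 * 2 = 6\<close> of them.\<close>

lemma card_lines: "card (lines V) * 6 = card V * (card V - 1)"
proof -
  let ?D = "{p \<in> V \<times> V. fst p \<noteq> snd p}"
  let ?t = "\<lambda>(a, b). line_through a b"
  have fin: "finite ?D" using finite_V by auto
  have pairs: "card {p \<in> l \<times> l. fst p \<noteq> snd p} = card l * (card l - 1)"
    if "finite l" for l :: "'g set"
  proof -
    have "{p \<in> l \<times> l. fst p \<noteq> snd p} = (SIGMA a : l. l - {a})" by auto
    then show ?thesis using that by simp
  qed
  have "card V * (card V - 1) = card ?D"
    by (rule pairs[OF finite_V, symmetric])
  also have "\<dots> = (\<Sum>l\<in>?t ` ?D. card {p \<in> ?D. ?t p = l})"
    using fin by (subst card_eq_sum, subst sum.image_gen[OF fin, of _ ?t]) simp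
  also have "?t ` ?D = lines V"
  proof (intro equalityI subsetI)
    fix l assume "l \<in> lines V"
    then obtain a b where "a \<in> l" "b \<in> l" "a \<noteq> b" "l \<subseteq> V"
      by (auto simp: lines_def card_3_iff)
    then show "l \<in> ?t ` ?D"
      using line_through_eq[OF \<open>l \<in> lines V\<close>] by (intro image_eqI[of _ _ "(a, b)"]) auto
  qed (auto intro: line_through_in_lines)
  also have "(\<Sum>l\<in>lines V. card {p \<in> ?D. ?t p = l}) = (\<Sum>l\<in>lines V. 6)"
  proof (rule sum.cong[OF refl])
    fix l assume l: "l \<in> lines V"
    then have "finite l" "card l = 3" "l \<subseteq> V"
      using card_ge_0_finite[of l] by (auto simp: lines_def)
    have "{p \<in> ?D. ?t p = l} = {p \<in> l \<times> l. fst p \<noteq> snd p}"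
    proof (intro equalityI subsetI)
      fix p assume "p \<in> {p \<in> ?D. ?t p = l}"
      then show "p \<in> {p \<in> l \<times> l. fst p \<noteq> snd p}"
        by (auto simp: line_through_def)
    next
      fix p assume "p \<in> {p \<in> l \<times> l. fst p \<noteq> snd p}"
      then show "p \<in> {p \<in> ?D. ?t p = l}"
        using line_through_eq[OF l] \<open>l \<subseteq> V\<close> by auto
    qed
    then show "card {p \<in> ?D. ?t p = l} = 6"
      using pairs[OF \<open>finite l\<close>] \<open>card l = 3\<close> by simp
  qed
  finally show ?thesis by simp
qed

text \<open>The candidates for the part of a system lying over \<open>l\<close>: only pairs whose
  images generate \<open>l\<close> have to be covered. Single points \<open>{a}\<close> and genuine
  lines are handled by the same formula.\<close>

definition blocks_over :: "'a set \<Rightarrow> ('a \<Rightarrow> 'g) \<Rightarrow> 'g set \<Rightarrow> 'a set set set"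
  where "blocks_over X f l = {C. (\<forall>b\<in>C. b \<subseteq> X \<and> card b = 3 \<and> f ` b = l) \<and>
    (\<forall>x\<in>X. \<forall>y\<in>X. x \<noteq> y \<and> line_through (f x) (f y) = l \<longrightarrow> (\<exists>!b. b \<in> C \<and> {x, y} \<subseteq> b))}"

end

lemma STS_on_iff:
  "STS_on X B \<longleftrightarrow> (\<forall>b\<in>B. b \<subseteq> X \<and> card b = 3) \<and>
    (\<forall>x\<in>X. \<forall>y\<in>X. x \<noteq> y \<longrightarrow> (\<exists>!b. b \<in> B \<and> {x, y} \<subseteq> b))" (is "_ \<longleftrightarrow> ?C \<and> ?D")
proof
  assume S: "STS_on X B"
  then have ?C by (auto simp: STS_on_def)
  moreover have ?D using STS_on_pair[OF S] by blast
  ultimately show "?C \<and> ?D" ..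
next
  assume C: "?C \<and> ?D"
  have "\<exists>!b. b \<in> B \<and> p \<subseteq> b" if p: "p \<subseteq> X \<and> card p = 2" for p
  proof -
    obtain x y where "p = {x, y}" "x \<noteq> y"
      using p by (auto simp: card_2_iff)
    with C p show ?thesis by simp
  qed
  with C show "STS_on X B" by (simp add: STS_on_def)
qed

section \<open>Decomposition over the fibres\<close>

context ternary_space
begin

definition line_types :: "'g set set"
  where "line_types = (\<lambda>a. {a}) ` V \<union> lines V"

lemma line_through_type: "a \<in> V \<Longrightarrow> b \<in> V \<Longrightarrow> line_through a b \<in> line_types"
  unfolding line_types_def
  by (cases "a = b") (auto simp: line_through_same line_through_in_lines)

lemma blocks_over_pair:
  assumes "C \<in> blocks_over X f l" "x \<in> X" "y \<in> X" "x \<noteq> y" "line_through (f x) (f y) = l"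
  shows "\<exists>!b. b \<in> C \<and> {x, y} \<subseteq> b"
  using assms by (simp add: blocks_over_def)

text \<open>A block inside one fibre sums to \<open>a + a + a = 0\<close>; a block mapped onto a
  line is mapped injectively, and the points of a line sum to zero.\<close>

lemma sum_over_type:
  assumes f: "\<And>x. x \<in> X \<Longrightarrow> f x \<in> V" and b: "b \<subseteq> X" "card b = 3" and l: "f ` b \<in> line_types"
  shows "(\<Sum>x\<in>b. f x) = 0"
proof -
  have fin: "finite b" by (rule card_ge_0_finite) (simp add: b(2))
  from l consider a where "a \<in> V" "f ` b = {a}" | "f ` b \<in> lines V"
    by (auto simp: line_types_def)
  then show ?thesis
  proof cases
    case 1
    obtain x y z where xyz: "b = {x, y, z}" "x \<noteq> y" "z \<noteq> x" "z \<noteq> y"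
      using b(2) by (auto simp: card_3_iff)
    then have "f x = a" "f y = a" "f z = a" using 1(2) by auto
    then show ?thesis
      using sum_triple[OF xyz(2-4), of f] triple[OF 1(1)] by (simp only: xyz(1))
  next
    case 2
    then have "inj_on f b"
      using b(2) fin by (intro eq_card_imp_inj_on) (simp_all add: lines_def)
    then have "(\<Sum>x\<in>b. f x) = (\<Sum>a\<in>f ` b. a)"
      by (simp add: sum.reindex)
    then show ?thesis using 2 by (simp add: lines_def)
  qed
qed

text \<open>The image of a block is generated by the images of any two of its points. A pair of
  points thus concerns only the component of type \<open>line_through (f x) (f y)\<close>, and the
  conditions on different components are independent.\<close>

lemma bij_betw_blocks_over:
  assumes f: "f \<in> X \<rightarrow>\<^sub>E V"
  shows "bij_betw (\<lambda>B. \<lambda>l\<in>line_types. {b \<in> B. f ` b = l})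
    {B. STS_on X B \<and> f \<in> homs X B V} (PiE line_types (blocks_over X f))"
proof (rule bij_betw_byWitness[where f' = "\<lambda>C. \<Union>l\<in>line_types. C l"])
  let ?split = "\<lambda>B. \<lambda>l\<in>line_types. {b \<in> B. f ` b = l}"
  let ?L = "{B. STS_on X B \<and> f \<in> homs X B V}"
  let ?R = "PiE line_types (blocks_over X f)"
  have fV: "f x \<in> V" if "x \<in> X" for x
    using f that by auto
  have image: "f ` b = line_through (f x) (f y)"
    if "f \<in> homs X B V" "STS_on X B" "b \<in> B" "x \<in> b" "y \<in> b" "x \<noteq> y" for B b x y
  proof (rule line_through_unique)
    show "(\<Sum>x\<in>b. f x) = 0" using that(1,3) by (auto simp: homs_def)
  qed (use that STS_on_block[OF that(2,3)] in auto)
  have type: "f ` b \<in> line_types" if h: "f \<in> homs X B V" "STS_on X B" "b \<in> B" for B b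
  proof -
    note blk = STS_on_block[OF h(2,3)]
    obtain x y where xy: "x \<in> b" "y \<in> b" "x \<noteq> y"
      using blk(2) by (auto simp: card_3_iff)
    show ?thesis
      unfolding image[OF h xy] using xy blk(1) fV by (intro line_through_type) auto
  qed
  have over: "b \<subseteq> X" "card b = 3" "f ` b = l" if "C \<in> ?R" "l \<in> line_types" "b \<in> C l" for C l b
    using PiE_mem[OF that(1,2)] that(3) by (auto simp: blocks_over_def)
  show "\<forall>B\<in>?L. (\<Union>l\<in>line_types. ?split B l) = B"
    using type by auto
  show "\<forall>C\<in>?R. ?split (\<Union>l\<in>line_types. C l) = C"
  proof
    fix C assume C: "C \<in> ?R"
    show "?split (\<Union>l\<in>line_types. C l) = C"
    proof (rule extensionalityI[of _ line_types])
      show "C \<in> extensional line_types" using C by (simp add: PiE_def)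
      show "?split (\<Union>l\<in>line_types. C l) l = C l" if "l \<in> line_types" for l
        using that over(3)[OF C] by auto
    qed simp
  qed
  show "?split ` ?L \<subseteq> ?R"
  proof (rule image_subsetI)
    fix B assume "B \<in> ?L"
    then have S: "STS_on X B" and h: "f \<in> homs X B V" by auto
    have "{b \<in> B. f ` b = l} \<in> blocks_over X f l" for l
      unfolding blocks_over_def mem_Collect_eq
    proof (intro conjI ballI impI)
      fix x y assume xy: "x \<in> X" "y \<in> X" and ne: "x \<noteq> y \<and> line_through (f x) (f y) = l"
      have "\<exists>!b. b \<in> B \<and> {x, y} \<subseteq> b" using STS_on_pair[OF S xy] ne by simp
      moreover have "f ` b = l" if "b \<in> B" "{x, y} \<subseteq> b" for b
        using image[OF h S that(1), of x y] that(2) ne by auto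
      ultimately show "\<exists>!b. (b \<in> B \<and> f ` b = l) \<and> {x, y} \<subseteq> b" by metis
    qed (use STS_on_block[OF S] in auto)
    then show "?split B \<in> ?R" by auto
  qed
  show "(\<lambda>C. \<Union>l\<in>line_types. C l) ` ?R \<subseteq> ?L"
  proof (rule image_subsetI)
    fix C assume C: "C \<in> ?R"
    let ?B = "\<Union>l\<in>line_types. C l"
    have sum: "(\<Sum>x\<in>b. f x) = 0" if b: "b \<in> ?B" for b
    proof -
      obtain l where l: "l \<in> line_types" "b \<in> C l" using b by auto
      show ?thesis
        by (rule sum_over_type[of X]) (use fV over[OF C l] l(1) in auto)
    qed
    have "\<exists>!b. b \<in> ?B \<and> {x, y} \<subseteq> b" if xy: "x \<in> X" "y \<in> X" "x \<noteq> y" for x y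
    proof -
      let ?l = "line_through (f x) (f y)"
      have l: "?l \<in> line_types" using fV xy by (intro line_through_type) auto
      have "\<exists>!b. b \<in> C ?l \<and> {x, y} \<subseteq> b"
        by (rule blocks_over_pair[OF PiE_mem[OF C l] xy refl])
      \<comment> \<open>No component of another type can contain a block through \<open>x\<close>
        and \<open>y\<close>.\<close>
      moreover have "b \<in> C ?l" if b: "b \<in> ?B" "{x, y} \<subseteq> b" for b
      proof -
        obtain l' where l': "l' \<in> line_types" "b \<in> C l'" using b by auto
        have "f ` b = ?l"
          by (rule line_through_unique) (use over[OF C l'] sum b xy in auto)
        with l' over(3)[OF C l'] show ?thesis by simp
      qed
      ultimately show ?thesis using l by (metis UN_I)
    qed
    moreover have "b \<subseteq> X \<and> card b = 3" if b: "b \<in> ?B" for b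
    proof -
      obtain l where l: "l \<in> line_types" "b \<in> C l" using b by auto
      show ?thesis using over[OF C l] by simp
    qed
    ultimately have "STS_on X ?B"
      by (intro iffD2[OF STS_on_iff] conjI ballI impI) simp_all
    moreover have "f \<in> homs X ?B V"
      using f sum by (auto simp: homs_def)
    ultimately show "?B \<in> ?L" by blast
  qed
qed

lemma card_STS_with_hom:
  assumes f: "f \<in> X \<rightarrow>\<^sub>E V"
  shows "card {B. STS_on X B \<and> f \<in> homs X B V} =
    (\<Prod>a\<in>V. card (blocks_over X f {a})) * (\<Prod>l\<in>lines V. card (blocks_over X f l))"
proof -
  have fin: "finite line_types"
    using finite_V by (simp add: line_types_def finite_lines)
  have disj: "(\<lambda>a. {a}) ` V \<inter> lines V = {}"
    by (auto simp: lines_def)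
  have "card {B. STS_on X B \<and> f \<in> homs X B V} = (\<Prod>l\<in>line_types. card (blocks_over X f l))"
    using bij_betw_same_card[OF bij_betw_blocks_over[OF f]] card_PiE[OF fin] by simp
  also have "\<dots> = (\<Prod>l\<in>(\<lambda>a. {a}) ` V. card (blocks_over X f l)) * (\<Prod>l\<in>lines V. card (blocks_over X f l))"
    unfolding line_types_def using finite_V disj by (intro prod.union_disjoint) (auto simp: finite_lines)
  finally show ?thesis
    by (simp add: prod.reindex)
qed

lemma blocks_over_singleton:
  assumes f: "f \<in> X \<rightarrow>\<^sub>E V" and a: "a \<in> V"
  shows "blocks_over X f {a} = {C. STS_on {x \<in> X. f x = a} C}"
proof -
  have l: "line_through (f x) (f y) = {a} \<longleftrightarrow> f x = a \<and> f y = a" for x y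
    using line_through_same[OF a] by (auto simp: line_through_def)
  have b: "b \<subseteq> X \<and> card b = 3 \<and> f ` b = {a} \<longleftrightarrow> b \<subseteq> {x \<in> X. f x = a} \<and> card b = 3" for b
  proof -
    have "b \<noteq> {}" if "card b = 3" using that by auto
    then show ?thesis by auto
  qed
  have q: "(\<forall>x\<in>X. \<forall>y\<in>X. x \<noteq> y \<and> f x = a \<and> f y = a \<longrightarrow> Q x y) \<longleftrightarrow>
      (\<forall>x\<in>{x \<in> X. f x = a}. \<forall>y\<in>{x \<in> X. f x = a}. x \<noteq> y \<longrightarrow> Q x y)" for Q
    by blast
  show ?thesis
    unfolding blocks_over_def STS_on_iff b l q ..
qed

end

section \<open>Transport of systems along bijections\<close>

lemma STS_on_image:
  assumes e: "bij_betw e M F" and S: "STS_on M B"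
  shows "STS_on F ((`) e ` B)"
proof -
  have inj: "inj_on e M" and im: "e ` M = F"
    using e by (auto simp: bij_betw_def)
  have sub: "b \<subseteq> M" if "b \<in> B" for b using STS_on_block(1)[OF S that] .
  have blk: "b \<subseteq> F \<and> card b = 3" if "b \<in> (`) e ` B" for b
    using that S im inj_on_subset[OF inj] by (auto simp: STS_on_def card_image)
  have mem: "e x \<in> e ` b \<longleftrightarrow> x \<in> b" if "x \<in> M" "b \<in> B" for x b
    using inj_on_image_mem_iff[OF inj that(1) sub[OF that(2)]] .
  have "\<exists>!c. c \<in> (`) e ` B \<and> {u, w} \<subseteq> c" if uw: "u \<in> F" "w \<in> F" "u \<noteq> w" for u w
  proof -
    obtain x y where xy: "x \<in> M" "y \<in> M" "u = e x" "w = e y" "x \<noteq> y"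
      using uw im by auto
    obtain b where b: "b \<in> B \<and> {x, y} \<subseteq> b"
      and u: "\<forall>b'. b' \<in> B \<and> {x, y} \<subseteq> b' \<longrightarrow> b' = b"
      using STS_on_pair[OF S xy(1,2,5)] by (elim ex1E)
    show ?thesis
    proof (rule ex1I[of _ "e ` b"])
      show "e ` b \<in> (`) e ` B \<and> {u, w} \<subseteq> e ` b" using b xy by auto
      fix c assume "c \<in> (`) e ` B \<and> {u, w} \<subseteq> c"
      then obtain b' where b': "b' \<in> B" "c = e ` b'" "{u, w} \<subseteq> c" by auto
      then have "{x, y} \<subseteq> b'" using mem[OF _ b'(1)] xy by auto
      with u b' show "c = e ` b" by simp
    qed
  qed
  with blk show ?thesis
    by (intro iffD2[OF STS_on_iff] conjI ballI impI) simp_all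
qed

lemma card_STS_on:
  assumes "finite F"
  shows "card {B. STS_on F B} = Psi (card F)"
proof -
  let ?M = "{1..card F}"
  obtain e where e: "bij_betw e ?M F"
    using ex_bij_betw_nat_finite_1[OF assms] by blast
  define e' where "e' = the_inv_into ?M e"
  have e': "bij_betw e' F ?M"
    unfolding e'_def by (rule bij_betw_the_inv_into[OF e])
  have inv: "e' (e x) = x" if "x \<in> ?M" for x
    unfolding e'_def using e that by (intro the_inv_into_f_f) (auto simp: bij_betw_def)
  have inv': "e (e' x) = x" if "x \<in> F" for x
    unfolding e'_def using e that by (intro f_the_inv_into_f) (auto simp: bij_betw_def)
  have "bij_betw (\<lambda>B. (`) e ` B) {B. STS_on ?M B} {B. STS_on F B}"
  proof (rule bij_betw_byWitness[where f' = "\<lambda>B. (`) e' ` B"])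
    have "(`) e' ` (`) e ` B = B" if S: "STS_on ?M B" for B
    proof -
      have "e' ` e ` b = b" if "b \<in> B" for b
        using STS_on_block(1)[OF S that] inv by (force simp: image_image)
      then show ?thesis by (simp add: image_image)
    qed
    then show "\<forall>B\<in>{B. STS_on ?M B}. (`) e' ` (`) e ` B = B" by blast
    have "(`) e ` (`) e' ` B = B" if S: "STS_on F B" for B
    proof -
      have "e ` e' ` b = b" if "b \<in> B" for b
        using STS_on_block(1)[OF S that] inv' by (force simp: image_image)
      then show ?thesis by (simp add: image_image)
    qed
    then show "\<forall>B\<in>{B. STS_on F B}. (`) e ` (`) e' ` B = B" by blast
  qed (use STS_on_image[OF e] STS_on_image[OF e'] in auto)
  then show ?thesis
    by (simp add: Psi_def is_STS_eq_STS_on bij_betw_same_card)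
qed

section \<open>Latin squares\<close>

lemma bij_betw_iff_ex1:
  "bij_betw f A B \<longleftrightarrow> f ` A \<subseteq> B \<and> (\<forall>y\<in>B. \<exists>!x. x \<in> A \<and> f x = y)" (is "?L \<longleftrightarrow> ?R")
proof
  assume ?L
  then have im: "f ` A = B" and inj: "inj_on f A" by (auto simp: bij_betw_def)
  have "\<exists>!x. x \<in> A \<and> f x = y" if "y \<in> B" for y
  proof -
    from that im obtain x where "x \<in> A" "y = f x" by blast
    then show ?thesis
      using inj by (intro ex1I[of _ x]) (auto dest: inj_onD)
  qed
  with im show ?R by simp
next
  assume R: ?R
  then have ex1: "\<exists>!x. x \<in> A \<and> f x = y" if "y \<in> B" for y
    using that by simp
  have "inj_on f A"
  proof (rule inj_onI)
    fix x y assume xy: "x \<in> A" "y \<in> A" "f x = f y"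
    then have "f x \<in> B" using R by blast
    from ex1[OF this] xy show "x = y" by (metis (no_types))
  qed
  moreover have "y \<in> f ` A" if "y \<in> B" for y
    using ex1_implies_ex[OF ex1[OF that]] by blast
  ultimately show ?L
    using R unfolding bij_betw_def by (metis subset_antisym subsetI)
qed

text \<open>Unique solvability for either argument is the form in which the covering of pairs across
  two fibres appears below.\<close>

lemma latin_squares_iff:
  "g \<in> latin_squares u \<longleftrightarrow> g \<in> ({1..u} \<times> {1..u}) \<rightarrow>\<^sub>E {1..u} \<and>
    (\<forall>i\<in>{1..u}. \<forall>k\<in>{1..u}. \<exists>!j. j \<in> {1..u} \<and> g (i, j) = k) \<and>
    (\<forall>j\<in>{1..u}. \<forall>k\<in>{1..u}. \<exists>!i. i \<in> {1..u} \<and> g (i, j) = k)"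
proof -
  define M where "M = {1..u}"
  have sub: "(\<lambda>j. g (i, j)) ` M \<subseteq> M" "(\<lambda>j. g (j, i)) ` M \<subseteq> M"
    if "g \<in> (M \<times> M) \<rightarrow>\<^sub>E M" "i \<in> M" for i
    using PiE_mem[OF that(1)] that(2) by auto
  have "bij_betw (\<lambda>j. g (i, j)) M M \<longleftrightarrow> (\<forall>k\<in>M. \<exists>!j. j \<in> M \<and> g (i, j) = k)"
    and "bij_betw (\<lambda>j. g (j, i)) M M \<longleftrightarrow> (\<forall>k\<in>M. \<exists>!j. j \<in> M \<and> g (j, i) = k)"
    if "g \<in> (M \<times> M) \<rightarrow>\<^sub>E M" "i \<in> M" for i
    by (simp_all only: bij_betw_iff_ex1 sub[OF that] simp_thms)
  then show ?thesis
    unfolding latin_squares_def mem_Collect_eq M_def[symmetric] by (simp cong: conj_cong ball_cong)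
qed

lemma ex1_image_iff:
  assumes "\<And>k k'. P k \<Longrightarrow> P k' \<Longrightarrow> h k = h k' \<Longrightarrow> k = k'"
    and "\<And>b. Q b \<longleftrightarrow> (\<exists>k. P k \<and> b = h k)"
  shows "(\<exists>!b. Q b) \<longleftrightarrow> (\<exists>!k. P k)"
  unfolding assms(2) using assms(1) by metis

context ternary_space
begin

lemma line_through_eq_iff:
  assumes "l \<in> lines V" "a \<in> V" "b \<in> V"
  shows "line_through a b = l \<longleftrightarrow> a \<in> l \<and> b \<in> l \<and> a \<noteq> b"
proof
  assume l: "line_through a b = l"
  then have "a \<noteq> b"
    using line_through_same[OF assms(2)] assms(1) by (auto simp: lines_def)
  with l show "a \<in> l \<and> b \<in> l \<and> a \<noteq> b"
    by (auto simp: line_through_def)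
qed (use line_through_eq[OF assms(1)] in auto)

text \<open>Once the three fibres over \<open>l\<close> are numbered by \<open>{1..u}\<close>, a
  block over \<open>l\<close> is a triple \<open>(i, j, k)\<close>. Covering the pairs between the
  fibres of \<open>a\<close> and \<open>b\<close> makes the blocks the graph of a function
  \<open>g (i, j) = k\<close>; covering the other two kinds of pairs makes \<open>g\<close> a latin
  square.\<close>

lemma card_blocks_over_line:
  assumes X: "finite X" and f: "f \<in> X \<rightarrow>\<^sub>E V" and l: "l \<in> lines V"
    and u: "\<And>a. a \<in> l \<Longrightarrow> card {x \<in> X. f x = a} = u"
  shows "card (blocks_over X f l) = Lambda u"
proof -
  define M where "M = {1..u}"
  obtain a b c where abc: "l = {a, b, c}" "a \<noteq> b" "b \<noteq> c" "a \<noteq> c"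
    using l by (auto simp: lines_def card_3_iff)
  have ex: "\<exists>e. bij_betw e M {x \<in> X. f x = d}" if "d \<in> l" for d
    using ex_bij_betw_nat_finite_1[of "{x \<in> X. f x = d}"] X u[OF that] by (simp add: M_def)
  obtain \<alpha> where \<alpha>: "bij_betw \<alpha> M {x \<in> X. f x = a}"
    using ex[of a] abc(1) by auto
  obtain \<beta> where \<beta>: "bij_betw \<beta> M {x \<in> X. f x = b}"
    using ex[of b] abc(1) by auto
  obtain \<gamma> where \<gamma>: "bij_betw \<gamma> M {x \<in> X. f x = c}"
    using ex[of c] abc(1) by auto
  have f\<alpha>: "\<alpha> i \<in> X" "f (\<alpha> i) = a" and f\<beta>: "\<beta> i \<in> X" "f (\<beta> i) = b"
    and f\<gamma>: "\<gamma> i \<in> X" "f (\<gamma> i) = c" if "i \<in> M" for i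
    using bij_betwE[OF \<alpha>] bij_betwE[OF \<beta>] bij_betwE[OF \<gamma>] that by auto
  have \<alpha>_inj: "\<alpha> i = \<alpha> i' \<longleftrightarrow> i = i'" and \<beta>_inj: "\<beta> i = \<beta> i' \<longleftrightarrow> i = i'"
    and \<gamma>_inj: "\<gamma> i = \<gamma> i' \<longleftrightarrow> i = i'" if "i \<in> M" "i' \<in> M" for i i'
    using \<alpha> \<beta> \<gamma> that by (auto simp: bij_betw_def inj_on_def)
  have \<alpha>_ex: "\<exists>i\<in>M. x = \<alpha> i" if "x \<in> X" "f x = a" for x
    using bij_betw_imp_surj_on[OF \<alpha>] that by blast
  have \<beta>_ex: "\<exists>i\<in>M. x = \<beta> i" if "x \<in> X" "f x = b" for x
    using bij_betw_imp_surj_on[OF \<beta>] that by blast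
  have \<gamma>_ex: "\<exists>i\<in>M. x = \<gamma> i" if "x \<in> X" "f x = c" for x
    using bij_betw_imp_surj_on[OF \<gamma>] that by blast
  have ne: "\<alpha> i \<noteq> \<beta> j" "\<alpha> i \<noteq> \<gamma> j" "\<beta> i \<noteq> \<gamma> j" if "i \<in> M" "j \<in> M" for i j
    using f\<alpha>(2)[OF that(1)] f\<beta>(2)[OF that(1)] f\<beta>(2)[OF that(2)] f\<gamma>(2)[OF that(2)] abc(2-4)
    by auto
  define t where "t i j k = {\<alpha> i, \<beta> j, \<gamma> k}" for i j k
  have mem: "\<alpha> i' \<in> t i j k \<longleftrightarrow> i' = i" "\<beta> i' \<in> t i j k \<longleftrightarrow> i' = j" "\<gamma> i' \<in> t i j k \<longleftrightarrow> i' = k"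
    if "i \<in> M" "j \<in> M" "k \<in> M" "i' \<in> M" for i j k i'
    using that ne[OF that(4)] ne[OF _ that(4)] ne[OF _ that(4), symmetric]
    by (simp_all add: t_def \<alpha>_inj \<beta>_inj \<gamma>_inj)
  have t_eq: "t i j k = t i' j' k' \<longleftrightarrow> i = i' \<and> j = j' \<and> k = k'"
    if "i \<in> M" "j \<in> M" "k \<in> M" "i' \<in> M" "j' \<in> M" "k' \<in> M" for i j k i' j' k'
    using mem that by metis
  have block: "d \<subseteq> X \<and> card d = 3 \<and> f ` d = l \<longleftrightarrow> (\<exists>i\<in>M. \<exists>j\<in>M. \<exists>k\<in>M. d = t i j k)" for d
  proof
    assume d: "d \<subseteq> X \<and> card d = 3 \<and> f ` d = l"
    then obtain x y z where xyz: "x \<in> d" "y \<in> d" "z \<in> d" "f x = a" "f y = b" "f z = c"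
      using abc(1) by (metis (no_types, lifting) imageE insertI1 insertI2)
    moreover have "finite d" using d card_ge_0_finite[of d] by simp
    moreover have "x \<noteq> y" "y \<noteq> z" "x \<noteq> z" using xyz abc(2-4) by auto
    then have "card {x, y, z} = 3" by simp
    ultimately have "d = {x, y, z}"
      using d by (intro card_subset_eq[symmetric]) auto
    moreover have "x \<in> X" "y \<in> X" "z \<in> X" using d xyz by auto
    ultimately show "\<exists>i\<in>M. \<exists>j\<in>M. \<exists>k\<in>M. d = t i j k"
      unfolding t_def using \<alpha>_ex \<beta>_ex \<gamma>_ex xyz by metis
  next
    assume "\<exists>i\<in>M. \<exists>j\<in>M. \<exists>k\<in>M. d = t i j k"
    then obtain i j k where d: "i \<in> M" "j \<in> M" "k \<in> M" "d = {\<alpha> i, \<beta> j, \<gamma> k}"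
      unfolding t_def by blast
    then show "d \<subseteq> X \<and> card d = 3 \<and> f ` d = l"
      using f\<alpha>[of i] f\<beta>[of j] f\<gamma>[of k] abc(1) ne[of i j] ne[of i k] ne[of j k] by simp
  qed
  \<comment> \<open>Each kind of pair across two fibres gives one condition of unique existence.
    Pairs within a fibre impose nothing here, since their images generate a single point.\<close>
  have crit: "C \<in> blocks_over X f l \<longleftrightarrow> (\<forall>d\<in>C. \<exists>i\<in>M. \<exists>j\<in>M. \<exists>k\<in>M. d = t i j k) \<and>
      (\<forall>i\<in>M. \<forall>j\<in>M. \<exists>!k. k \<in> M \<and> t i j k \<in> C) \<and>
      (\<forall>i\<in>M. \<forall>k\<in>M. \<exists>!j. j \<in> M \<and> t i j k \<in> C) \<and>
      (\<forall>j\<in>M. \<forall>k\<in>M. \<exists>!i. i \<in> M \<and> t i j k \<in> C)" (is "_ \<longleftrightarrow> ?A \<and> ?B1 \<and> ?B2 \<and> ?B3") for C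
  proof -
    let ?Q = "\<lambda>x y. \<exists>!d. d \<in> C \<and> {x, y} \<subseteq> d"
    have "(\<forall>x\<in>X. \<forall>y\<in>X. x \<noteq> y \<and> line_through (f x) (f y) = l \<longrightarrow> ?Q x y) \<longleftrightarrow> ?B1 \<and> ?B2 \<and> ?B3"
      if A: ?A
    proof -
      have sym: "?Q x y = ?Q y x" for x y
        by (simp add: insert_commute)
      \<comment> \<open>A block through \<open>\<alpha> i\<close> and \<open>\<beta> j\<close> is
        \<open>t i j k\<close> for some \<open>k\<close>, and \<open>t i j\<close> is injective on
        \<open>M\<close>; a unique block therefore means a unique label.\<close>
      have 1: "?Q (\<alpha> i) (\<beta> j) \<longleftrightarrow> (\<exists>!k. k \<in> M \<and> t i j k \<in> C)" if "i \<in> M" "j \<in> M" for i j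
      proof (rule ex1_image_iff[where h = "t i j"])
        show "d \<in> C \<and> {\<alpha> i, \<beta> j} \<subseteq> d \<longleftrightarrow> (\<exists>k. (k \<in> M \<and> t i j k \<in> C) \<and> d = t i j k)" for d
          using A mem that by (metis empty_subsetI insert_subset)
      qed (use t_eq that in auto)
      have 2: "?Q (\<alpha> i) (\<gamma> k) \<longleftrightarrow> (\<exists>!j. j \<in> M \<and> t i j k \<in> C)" if "i \<in> M" "k \<in> M" for i k
      proof (rule ex1_image_iff[where h = "\<lambda>j. t i j k"])
        show "d \<in> C \<and> {\<alpha> i, \<gamma> k} \<subseteq> d \<longleftrightarrow> (\<exists>j. (j \<in> M \<and> t i j k \<in> C) \<and> d = t i j k)" for d
          using A mem that by (metis empty_subsetI insert_subset)
      qed (use t_eq that in auto)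
      have 3: "?Q (\<beta> j) (\<gamma> k) \<longleftrightarrow> (\<exists>!i. i \<in> M \<and> t i j k \<in> C)" if "j \<in> M" "k \<in> M" for j k
      proof (rule ex1_image_iff[where h = "\<lambda>i. t i j k"])
        show "d \<in> C \<and> {\<beta> j, \<gamma> k} \<subseteq> d \<longleftrightarrow> (\<exists>i. (i \<in> M \<and> t i j k \<in> C) \<and> d = t i j k)" for d
          using A mem that by (metis empty_subsetI insert_subset)
      qed (use t_eq that in auto)
      show ?thesis
      proof
        assume Q: "\<forall>x\<in>X. \<forall>y\<in>X. x \<noteq> y \<and> line_through (f x) (f y) = l \<longrightarrow> ?Q x y"
        have Q': "?Q x y" if "x \<in> X" "y \<in> X" "f x \<in> l" "f y \<in> l" "f x \<noteq> f y" for x y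
        proof -
          have "x \<noteq> y \<and> line_through (f x) (f y) = l"
            using line_through_eq[OF l that(3-5)] that(5) by auto
          then show ?thesis using Q[rule_format, OF that(1,2)] by blast
        qed
        have "?Q (\<alpha> i) (\<beta> j)" "?Q (\<alpha> i) (\<gamma> j)" "?Q (\<beta> i) (\<gamma> j)" if "i \<in> M" "j \<in> M" for i j
          using f\<alpha> f\<beta> f\<gamma> that abc by (intro Q'; simp)+
        then show "?B1 \<and> ?B2 \<and> ?B3"
          using 1 2 3 by simp
      next
        assume B: "?B1 \<and> ?B2 \<and> ?B3"
        have Q1: "?Q (\<alpha> i) (\<beta> j)" if "i \<in> M" "j \<in> M" for i j
          unfolding 1[OF that] by (rule B[THEN conjunct1, rule_format, OF that])
        have Q2: "?Q (\<alpha> i) (\<gamma> k)" if "i \<in> M" "k \<in> M" for i k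
          unfolding 2[OF that] by (rule B[THEN conjunct2, THEN conjunct1, rule_format, OF that])
        have Q3: "?Q (\<beta> j) (\<gamma> k)" if "j \<in> M" "k \<in> M" for j k
          unfolding 3[OF that] by (rule B[THEN conjunct2, THEN conjunct2, rule_format, OF that])
        show "\<forall>x\<in>X. \<forall>y\<in>X. x \<noteq> y \<and> line_through (f x) (f y) = l \<longrightarrow> ?Q x y"
        proof (intro ballI impI)
          fix x y assume x: "x \<in> X" and y: "y \<in> X" and "x \<noteq> y \<and> line_through (f x) (f y) = l"
          then have fxy: "f x \<in> {a, b, c}" "f y \<in> {a, b, c}" "f x \<noteq> f y"
            using line_through_eq_iff[OF l, of "f x" "f y"] PiE_mem[OF f] abc(1) by auto
          \<comment> \<open>The last three cases are the first three with \<open>x\<close> and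
            \<open>y\<close> exchanged.\<close>
          then consider "f x = a" "f y = b" | "f x = a" "f y = c" | "f x = b" "f y = c"
            | "f y = a" "f x = b" | "f y = a" "f x = c" | "f y = b" "f x = c"
            by (elim insertE emptyE) simp_all
          then show "?Q x y"
          proof cases
            case a: 1
            obtain i j where "i \<in> M" "j \<in> M" and eq: "x = \<alpha> i" "y = \<beta> j"
              using \<alpha>_ex[OF x a(1)] \<beta>_ex[OF y a(2)] by blast
            from Q1[OF this(1,2)] show ?thesis
              unfolding eq .
          next
            case a: 2
            obtain i j where "i \<in> M" "j \<in> M" and eq: "x = \<alpha> i" "y = \<gamma> j"
              using \<alpha>_ex[OF x a(1)] \<gamma>_ex[OF y a(2)] by blast
            from Q2[OF this(1,2)] show ?thesis
              unfolding eq .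
          next
            case a: 3
            obtain i j where "i \<in> M" "j \<in> M" and eq: "x = \<beta> i" "y = \<gamma> j"
              using \<beta>_ex[OF x a(1)] \<gamma>_ex[OF y a(2)] by blast
            from Q3[OF this(1,2)] show ?thesis
              unfolding eq .
          next
            case a: 4
            obtain i j where "i \<in> M" "j \<in> M" and eq: "y = \<alpha> i" "x = \<beta> j"
              using \<alpha>_ex[OF y a(1)] \<beta>_ex[OF x a(2)] by blast
            from Q1[OF this(1,2)] show ?thesis
              unfolding eq by (subst sym)
          next
            case a: 5
            obtain i j where "i \<in> M" "j \<in> M" and eq: "y = \<alpha> i" "x = \<gamma> j"
              using \<alpha>_ex[OF y a(1)] \<gamma>_ex[OF x a(2)] by blast
            from Q2[OF this(1,2)] show ?thesis
              unfolding eq by (subst sym)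
          next
            case a: 6
            obtain i j where "i \<in> M" "j \<in> M" and eq: "y = \<beta> i" "x = \<gamma> j"
              using \<beta>_ex[OF y a(1)] \<gamma>_ex[OF x a(2)] by blast
            from Q3[OF this(1,2)] show ?thesis
              unfolding eq by (subst sym)
          qed
        qed
      qed
    qed
    then show ?thesis
      unfolding blocks_over_def mem_Collect_eq block by (rule conj_cong[OF refl])
  qed
  have latin: "g \<in> latin_squares u \<longleftrightarrow> g \<in> (M \<times> M) \<rightarrow>\<^sub>E M \<and>
      (\<forall>i\<in>M. \<forall>k\<in>M. \<exists>!j. j \<in> M \<and> g (i, j) = k) \<and>
      (\<forall>j\<in>M. \<forall>k\<in>M. \<exists>!i. i \<in> M \<and> g (i, j) = k)" for g
    unfolding latin_squares_iff M_def ..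
  define G where "G g = (\<lambda>(i, j). t i j (g (i, j))) ` (M \<times> M)" for g
  have t_G: "t i j k \<in> G g \<longleftrightarrow> g (i, j) = k"
    if g: "g \<in> (M \<times> M) \<rightarrow>\<^sub>E M" and ijk: "i \<in> M" "j \<in> M" "k \<in> M" for g i j k
  proof
    assume "t i j k \<in> G g"
    then obtain i' j' where "i' \<in> M" "j' \<in> M" "t i j k = t i' j' (g (i', j'))"
      unfolding G_def by auto
    moreover from this have "g (i', j') \<in> M" using PiE_mem[OF g] by simp
    ultimately show "g (i, j) = k" using t_eq ijk by auto
  qed (use ijk in \<open>auto simp: G_def\<close>)
  have "bij_betw G (latin_squares u) (blocks_over X f l)"
    unfolding bij_betw_def
  proof
    show "inj_on G (latin_squares u)"
    proof (rule inj_onI)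
      fix g h assume gh: "g \<in> latin_squares u" "h \<in> latin_squares u" "G g = G h"
      then have g: "g \<in> (M \<times> M) \<rightarrow>\<^sub>E M" and h: "h \<in> (M \<times> M) \<rightarrow>\<^sub>E M"
        by (simp_all add: latin)
      show "g = h"
      proof (rule PiE_ext[OF g h])
        fix p assume "p \<in> M \<times> M"
        then obtain i j where p: "p = (i, j)" "i \<in> M" "j \<in> M" by auto
        then have "g (i, j) \<in> M" using PiE_mem[OF g] by simp
        then show "g p = h p"
          using t_G[OF g p(2,3), of "g (i, j)"] t_G[OF h p(2,3), of "g (i, j)"] gh(3) p(1) by simp
      qed
    qed
    show "G ` latin_squares u = blocks_over X f l"
    proof (intro equalityI subsetI)
      fix C assume "C \<in> G ` latin_squares u"
      then obtain g where C: "C = G g" and g: "g \<in> latin_squares u" by auto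
      then have gM: "g \<in> (M \<times> M) \<rightarrow>\<^sub>E M" by (simp add: latin)
      have "\<forall>d\<in>C. \<exists>i\<in>M. \<exists>j\<in>M. \<exists>k\<in>M. d = t i j k"
      proof
        fix d assume "d \<in> C"
        then obtain i j where "i \<in> M" "j \<in> M" "d = t i j (g (i, j))"
          unfolding C G_def by auto
        moreover from this have "g (i, j) \<in> M" using PiE_mem[OF gM] by simp
        ultimately show "\<exists>i\<in>M. \<exists>j\<in>M. \<exists>k\<in>M. d = t i j k" by blast
      qed
      moreover have "\<exists>!k. k \<in> M \<and> t i j k \<in> C" if "i \<in> M" "j \<in> M" for i j
        using t_G[OF gM that] PiE_mem[OF gM, of "(i, j)"] that
        unfolding C by (intro ex1I[of _ "g (i, j)"]) auto
      moreover have "\<exists>!j. j \<in> M \<and> t i j k \<in> C" if "i \<in> M" "k \<in> M" for i k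
      proof -
        have "j \<in> M \<and> t i j k \<in> C \<longleftrightarrow> j \<in> M \<and> g (i, j) = k" for j
          using t_G[OF gM that(1) _ that(2)] unfolding C by auto
        then show ?thesis using g that unfolding latin by simp
      qed
      moreover have "\<exists>!i. i \<in> M \<and> t i j k \<in> C" if "j \<in> M" "k \<in> M" for j k
      proof -
        have "i \<in> M \<and> t i j k \<in> C \<longleftrightarrow> i \<in> M \<and> g (i, j) = k" for i
          using t_G[OF gM _ that] unfolding C by auto
        then show ?thesis using g that unfolding latin by simp
      qed
      ultimately show "C \<in> blocks_over X f l"
        unfolding crit by simp
    next
      fix C assume "C \<in> blocks_over X f l"
      note this[unfolded crit]
      note C0 = this[THEN conjunct1] and C1 = this[THEN conjunct2, THEN conjunct1]
        and C2 = this[THEN conjunct2, THEN conjunct2, THEN conjunct1]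
        and C3 = this[THEN conjunct2, THEN conjunct2, THEN conjunct2]
      \<comment> \<open>The third label as a function of the other two; \<open>C1\<close> makes the
        description proper.\<close>
      define g where "g = (\<lambda>(i, j)\<in>M \<times> M. THE k. k \<in> M \<and> t i j k \<in> C)"
      have g: "g (i, j) \<in> M \<and> t i j (g (i, j)) \<in> C" if "i \<in> M" "j \<in> M" for i j
        using theI'[OF C1[rule_format, OF that]] that by (simp add: g_def)
      have gM: "g \<in> (M \<times> M) \<rightarrow>\<^sub>E M"
        using g by (auto simp: PiE_iff) (simp add: g_def)
      have t_C: "t i j k \<in> C \<longleftrightarrow> g (i, j) = k" if "i \<in> M" "j \<in> M" "k \<in> M" for i j k
        using g[OF that(1,2)] C1[rule_format, OF that(1,2)] that(3) by (metis (no_types))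
      have "G g = C"
      proof (intro equalityI subsetI)
        fix d assume "d \<in> G g"
        then show "d \<in> C" using g unfolding G_def by auto
      next
        fix d assume d: "d \<in> C"
        then obtain i j k where "i \<in> M" "j \<in> M" "k \<in> M" "d = t i j k"
          using C0 by blast
        then show "d \<in> G g" using d t_C t_G[OF gM] by simp
      qed
      moreover have "g \<in> latin_squares u"
      proof -
        have "j \<in> M \<and> t i j k \<in> C \<longleftrightarrow> j \<in> M \<and> g (i, j) = k" if "i \<in> M" "k \<in> M" for i j k
          using t_C that by auto
        then have "\<exists>!j. j \<in> M \<and> g (i, j) = k" if "i \<in> M" "k \<in> M" for i k
          using C2[rule_format, OF that] that by simp
        moreover have "i \<in> M \<and> t i j k \<in> C \<longleftrightarrow> i \<in> M \<and> g (i, j) = k" if "j \<in> M" "k \<in> M" for i j k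
          using t_C that by auto
        then have "\<exists>!i. i \<in> M \<and> g (i, j) = k" if "j \<in> M" "k \<in> M" for j k
          using C3[rule_format, OF that] that by simp
        ultimately show ?thesis
          unfolding latin using gM by simp
      qed
      ultimately show "C \<in> G ` latin_squares u" by blast
    qed
  qed
  from bij_betw_same_card[OF this] show ?thesis
    by (simp add: Lambda_def)
qed

end

section \<open>Gaussian binomial inversion\<close>

text \<open>The Gaussian binomial coefficient for \<open>q = 3\<close>, given by the q-Pascal
  recursion.\<close>

fun gauss3 :: "nat \<Rightarrow> nat \<Rightarrow> real" where
  "gauss3 n 0 = 1"
| "gauss3 0 (Suc m) = 0"
| "gauss3 (Suc n) (Suc m) = gauss3 n m + 3 ^ Suc m * gauss3 n (Suc m)"

text \<open>The q-factorial for \<open>q = 3\<close> without the denominators \<open>q - 1\<close>;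
  it is the product occurring in \<open>Gamma\<close>.\<close>

definition qfact3 :: "nat \<Rightarrow> real"
  where "qfact3 n = (\<Prod>s = 1..n. 3 ^ s - 1)"

lemma qfact3_0 [simp]: "qfact3 0 = 1"
  by (simp add: qfact3_def)

lemma qfact3_Suc: "qfact3 (Suc n) = qfact3 n * (3 ^ Suc n - 1)"
  by (simp add: qfact3_def)

lemma qfact3_pos: "qfact3 n > 0"
  unfolding qfact3_def by (intro prod_pos) (auto simp: one_less_power)

lemma gauss3_eq_0: "n < m \<Longrightarrow> gauss3 n m = 0"
  by (induction n m rule: gauss3.induct) auto

lemma gauss3_self: "gauss3 n n = 1"
  by (induction n) (auto simp: gauss3_eq_0)

lemma gauss3_qfact3: "m \<le> n \<Longrightarrow> gauss3 n m * (qfact3 m * qfact3 (n - m)) = qfact3 n"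
proof (induction n m rule: gauss3.induct)
  case (3 n m)
  have "gauss3 n (Suc m) * (qfact3 (Suc m) * qfact3 (n - m)) = qfact3 n * (3 ^ (n - m) - 1)"
  proof (cases "m = n")
    case False
    with 3 have "Suc (n - Suc m) = n - m" "Suc m \<le> n" by auto
    then show ?thesis
      using 3(2) qfact3_Suc[of "n - Suc m"] by (simp add: mult_ac)
  qed (simp add: gauss3_eq_0)
  moreover have "gauss3 n m * (qfact3 (Suc m) * qfact3 (n - m)) = qfact3 n * (3 ^ Suc m - 1)"
    using 3 by (simp add: qfact3_Suc mult_ac)
  ultimately have "gauss3 (Suc n) (Suc m) * (qfact3 (Suc m) * qfact3 (n - m)) =
      qfact3 n * (3 ^ Suc m - 1) + 3 ^ Suc m * (qfact3 n * (3 ^ (n - m) - 1))"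
    by (simp only: gauss3.simps distrib_right mult.assoc)
  also have "\<dots> = qfact3 n * (3 ^ Suc m - 1 + 3 ^ Suc m * (3 ^ (n - m) - 1))"
    by (simp only: distrib_left mult.left_commute)
  \<comment> \<open>The q-analogue of \<open>(m + 1) + (n - m) = n + 1\<close>.\<close>
  also have "(3 :: real) ^ Suc m - 1 + 3 ^ Suc m * (3 ^ (n - m) - 1) = 3 ^ Suc n - 1"
    using 3 by (simp add: algebra_simps flip: power_add)
  finally show ?case by (simp add: qfact3_Suc)
qed auto

lemma choose_2_Suc: "Suc m choose 2 = (m choose 2) + m"
  by (simp add: numeral_2_eq_2)

text \<open>The partial sums telescope, by the \<open>q\<close>-Pascal recursion.\<close>

lemma sum_mu3_gauss3_partial:
  "(\<Sum>m\<le>M. mu3 m * gauss3 (Suc n) m) = (-1) ^ M * 3 ^ (Suc M choose 2) * gauss3 n M"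
proof (induction M)
  case 0
  then show ?case by (simp add: mu3_def numeral_2_eq_2)
next
  case (Suc M)
  then show ?case
    by (simp add: mu3_def choose_2_Suc[of "Suc M"] power_add algebra_simps)
qed

text \<open>For \<open>n > 0\<close> the closed form of the partial sum, taken at
  \<open>M = n\<close>, contains the factor \<open>gauss3 (n - 1) n = 0\<close>.\<close>

lemma sum_mu3_gauss3: "(\<Sum>m\<le>n. mu3 m * gauss3 n m) = of_bool (n = 0)"
proof (cases n)
  case 0
  then show ?thesis by (simp add: mu3_def numeral_2_eq_2)
next
  case (Suc n')
  then show ?thesis by (simp add: sum_mu3_gauss3_partial gauss3_eq_0 del: sum.atMost_Suc)
qed

section \<open>Surjection counts, their Gaussian binomial form and their inversion\<close>

definition surj_count :: "nat \<Rightarrow> nat \<Rightarrow> real"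
  where "surj_count d j = (\<Prod>t<j. 3 ^ (d + 1) - 3 ^ (t + 1))"

lemma gauss3_step:
  "j \<le> d \<Longrightarrow> gauss3 d (Suc j) * (3 ^ Suc j - 1) = gauss3 d j * (3 ^ (d - j) - 1)"
proof (cases "j = d")
  case False
  assume "j \<le> d"
  with False have j: "Suc (d - Suc j) = d - j" "Suc j \<le> d" by auto
  let ?q = "qfact3 j * qfact3 (d - Suc j)"
  have "gauss3 d (Suc j) * (3 ^ Suc j - 1) * ?q = qfact3 d"
    using gauss3_qfact3[OF j(2)] by (simp add: qfact3_Suc mult_ac)
  moreover have "gauss3 d j * (3 ^ (d - j) - 1) * ?q = qfact3 d"
    using gauss3_qfact3[of j d] qfact3_Suc[of "d - Suc j"] j \<open>j \<le> d\<close> by (simp add: mult_ac)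
  moreover have "?q \<noteq> 0" using qfact3_pos by (simp add: less_imp_neq[symmetric])
  ultimately show ?thesis by (metis mult_right_cancel)
qed (simp add: gauss3_eq_0)

text \<open>For \<open>t \<le> d\<close> a factor is \<open>3 ^ (t + 1) * (3 ^ (d - t) - 1)\<close>.
  The powers of 3 have exponents \<open>1\<close> to \<open>j\<close>, with sum
  \<open>Suc j choose 2\<close>; the rest is a quotient of q-factorials. For \<open>j > d\<close>
  both sides vanish.\<close>

lemma surj_count_eq: "surj_count d j = 3 ^ (Suc j choose 2) * qfact3 j * gauss3 d j"
proof (induction j)
  case 0
  then show ?case by (simp add: surj_count_def numeral_2_eq_2)
next
  case (Suc j)
  have "surj_count d (Suc j) = surj_count d j * (3 ^ (d + 1) - 3 ^ (j + 1))"
    by (simp add: surj_count_def)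
  also have "\<dots> = 3 ^ (Suc j choose 2) * qfact3 j * (gauss3 d j * (3 ^ (d + 1) - 3 ^ (j + 1)))"
    by (simp add: Suc)
  also have "gauss3 d j * (3 ^ (d + 1) - 3 ^ (j + 1)) =
      3 ^ Suc j * (gauss3 d (Suc j) * (3 ^ Suc j - 1))"
  proof (cases "j \<le> d")
    case True
    then have "(3 :: real) ^ (d + 1) - 3 ^ (j + 1) = 3 ^ Suc j * (3 ^ (d - j) - 1)"
      by (simp add: algebra_simps flip: power_add)
    then show ?thesis using gauss3_step[OF True] by (simp add: mult_ac)
  qed (simp add: gauss3_eq_0)
  finally show ?case
    by (simp add: choose_2_Suc[of "Suc j"] qfact3_Suc power_add mult_ac)
qed

text \<open>The q-analogue of \<open>(d choose j) * (j choose i) = (d choose i) * ((d - i) choose (j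
  - i))\<close>: both sides become \<open>qfact3 d\<close> after multiplication by
  \<open>?q\<close>.\<close>

lemma gauss3_mult:
  assumes "i \<le> j" "j \<le> d"
  shows "gauss3 d j * gauss3 j i = gauss3 d i * gauss3 (d - i) (j - i)"
proof -
  let ?q = "qfact3 i * qfact3 (j - i) * qfact3 (d - j)"
  have e: "d - i - (j - i) = d - j" using assms by simp
  have "gauss3 d j * gauss3 j i * ?q = gauss3 d j * (qfact3 j * qfact3 (d - j))"
    by (simp add: mult_ac flip: gauss3_qfact3[OF assms(1)])
  also have "\<dots> = qfact3 d" by (rule gauss3_qfact3[OF assms(2)])
  finally have 1: "gauss3 d j * gauss3 j i * ?q = qfact3 d" .
  have "gauss3 d i * gauss3 (d - i) (j - i) * ?q = gauss3 d i * (qfact3 i * qfact3 (d - i))"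
    using gauss3_qfact3[of "j - i" "d - i"] assms by (simp add: e mult_ac)
  also have "\<dots> = qfact3 d" using assms by (intro gauss3_qfact3) simp
  finally have "gauss3 d j * gauss3 j i * ?q = gauss3 d i * gauss3 (d - i) (j - i) * ?q"
    using 1 by simp
  moreover have "?q \<noteq> 0" using qfact3_pos by (simp add: less_imp_neq[symmetric])
  ultimately show ?thesis by (metis mult_right_cancel)
qed

text \<open>The powers of 3 cancel, and \<open>qfact3 j\<close> combines with the denominator to
  \<open>gauss3 j i\<close>. After \<open>gauss3_mult\<close> the factor \<open>gauss3 d i\<close>
  comes out and \<open>sum_mu3_gauss3\<close> applies. The coefficients do not mention
  \<open>d\<close>, so the same combination serves all systems at once.\<close>

lemma gauss3_inversion:
  assumes "d \<le> k"
  shows "(\<Sum>j = i..k. mu3 (j - i) / (3 ^ (Suc j choose 2) * qfact3 i * qfact3 (j - i)) * surj_count d j)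
    = of_bool (d = i)"
proof -
  have "mu3 (j - i) / (3 ^ (Suc j choose 2) * qfact3 i * qfact3 (j - i)) * surj_count d j =
      mu3 (j - i) * (gauss3 d j * gauss3 j i)" if "i \<le> j" for j
  proof -
    have "gauss3 j i = qfact3 j / (qfact3 i * qfact3 (j - i))"
      using gauss3_qfact3[OF that] qfact3_pos[of i] qfact3_pos[of "j - i"]
      by (simp add: field_simps)
    then show ?thesis by (simp add: surj_count_eq)
  qed
  then have "(\<Sum>j = i..k. mu3 (j - i) / (3 ^ (Suc j choose 2) * qfact3 i * qfact3 (j - i)) * surj_count d j)
      = (\<Sum>j = i..k. mu3 (j - i) * (gauss3 d j * gauss3 j i))"
    by (intro sum.cong) auto
  \<comment> \<open>Terms with \<open>j > d\<close> vanish, so the common bound \<open>k\<close> may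
    be lowered to \<open>d\<close>.\<close>
  also have "\<dots> = (\<Sum>j = i..d. mu3 (j - i) * (gauss3 d j * gauss3 j i))"
    using assms by (intro sum.mono_neutral_right) (auto simp: gauss3_eq_0)
  also have "\<dots> = of_bool (d = i)"
  proof (cases "i \<le> d")
    case True
    have "(\<Sum>j = i..d. mu3 (j - i) * (gauss3 d j * gauss3 j i)) =
        (\<Sum>j = i..d. mu3 (j - i) * (gauss3 d i * gauss3 (d - i) (j - i)))"
      by (intro sum.cong refl) (simp add: gauss3_mult)
    also have "\<dots> = (\<Sum>m\<le>d - i. mu3 m * (gauss3 d i * gauss3 (d - i) m))"
      using True by (intro sum.reindex_bij_witness[of _ "\<lambda>m. m + i" "\<lambda>j. j - i"]) auto
    also have "\<dots> = gauss3 d i * (\<Sum>m\<le>d - i. mu3 m * gauss3 (d - i) m)"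
      by (simp add: sum_distrib_left mult_ac)
    also have "\<dots> = of_bool (d = i)"
      using True by (simp add: sum_mu3_gauss3 gauss3_self)
    finally show ?thesis .
  qed auto
  finally show ?thesis .
qed

text \<open>The powers of \<open>fact (v div 3 ^ i)\<close> cancel, and the two exponents of 3 add
  up to \<open>Suc j choose 2\<close>. This produces the denominator of the coefficient in
  \<open>gauss3_inversion\<close>.\<close>

lemma Gamma_mult:
  assumes "i \<le> j"
  shows "Gamma v 0 i * Gamma v i j =
    fact v / (3 ^ (Suc j choose 2) * fact (v div 3 ^ j) ^ (3 ^ j) * qfact3 i * qfact3 (j - i))"
proof -
  obtain m where j: "j = i + m" using assms le_Suc_ex by blast
  \<comment> \<open>Splitting off the even number \<open>2 * (i * m)\<close> lets the truncating
    \<open>div 2\<close> distribute.\<close>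
  have "(j + i + 1) * (j - i) = 2 * (i * m) + m * Suc m"
    by (simp add: j algebra_simps)
  then have "(j + i + 1) * (j - i) div 2 = i * m + m * Suc m div 2"
    by simp
  moreover have "Suc n choose 2 = n * Suc n div 2" for n
    by (simp add: choose_two mult.commute)
  moreover have "Suc (i + m) choose 2 = (Suc i choose 2) + (i * m + (Suc m choose 2))" for i m
    by (induction m) (simp_all add: choose_2_Suc[of "Suc _"] choose_2_Suc[of "Suc (_ + _)"] numeral_2_eq_2)
  ultimately have "(i + 0 + 1) * (i - 0) div 2 + (j + i + 1) * (j - i) div 2 = Suc j choose 2"
    by (simp add: j mult.commute)
  then have "(3 :: real) ^ (Suc j choose 2) =
      3 ^ ((i + 0 + 1) * (i - 0) div 2) * 3 ^ ((j + i + 1) * (j - i) div 2)"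
    by (metis power_add)
  moreover have "(fact (v div 3 ^ i) :: real) ^ (3 ^ i) \<noteq> 0" by simp
  ultimately show ?thesis
    unfolding Gamma_def qfact3_def by (simp add: mult_ac)
qed

section \<open>Double counting\<close>

lemma three_power_dvd_of_surj_hom:
  assumes "finite X" "STS_on X B" "f \<in> surj_homs X B j"
  shows "3 ^ j dvd card X"
proof -
  interpret ternary_space "coords j" by (rule ternary_space_coords)
  have "0 \<in> coords j" by (simp add: coords_def)
  then have "card {x \<in> X. f x = 0} * 3 ^ j = card X"
    using card_fibre[OF assms(1,2), of f 0] assms(3) by (simp add: surj_homs_def card_coords)
  then show ?thesis
    by (metis dvd_triv_right)
qed

text \<open>One inclusion is \<open>card_fibre\<close>; for the other, \<open>u > 0\<close> because
  \<open>X\<close> is nonempty, so no fibre is empty. The maps can thus be chosen before the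
  system.\<close>

lemma surj_homs_eq_equidistributed:
  assumes X: "finite X" "X \<noteq> {}" and S: "STS_on X B" and j: "card X = 3 ^ j * u"
  shows "surj_homs X B j = {f \<in> equidistributed X (coords j) u. f \<in> homs X B (coords j)}"
proof -
  interpret ternary_space "coords j" by (rule ternary_space_coords)
  have "card {x \<in> X. f x = a} = u"
    if "f \<in> surj_homs X B j" "a \<in> coords j" for f a
    using card_fibre[OF X(1) S _ _ that(2), of f] that(1) j
    unfolding surj_homs_def card_coords by simp
  moreover have "f ` X = coords j"
    if f: "f \<in> equidistributed X (coords j) u" for f
  proof
    show "f ` X \<subseteq> coords j" using f by (auto simp: equidistributed_def)
    have "u > 0" using X j by (metis card_gt_0_iff gr0I mult_0_right less_irrefl)
    show "coords j \<subseteq> f ` X"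
    proof
      fix a assume "a \<in> coords j"
      then have "card {x \<in> X. f x = a} = u" using f by (simp add: equidistributed_def)
      then have "{x \<in> X. f x = a} \<noteq> {}" using \<open>u > 0\<close> by (metis card.empty less_irrefl)
      then show "a \<in> f ` X" by blast
    qed
  qed
  ultimately show ?thesis
    unfolding surj_homs_def equidistributed_def homs_def by blast
qed

lemma sum_card_swap:
  assumes "finite A" "finite B"
  shows "(\<Sum>a\<in>A. card {b \<in> B. R a b}) = (\<Sum>b\<in>B. card {a \<in> A. R a b})"
  using sum.swap_restrict[OF assms, of "\<lambda>_ _. 1 :: nat" R] by simp

lemma sum_card_surj_homs:
  assumes X: "finite X" "X \<noteq> {}" and j: "card X = 3 ^ j * u"
  shows "(\<Sum>B | STS_on X B. card (surj_homs X B j)) * fact u ^ (3 ^ j) =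
    fact (card X) * (Psi u ^ (3 ^ j) * Lambda u ^ (3 ^ j * (3 ^ j - 1) div 6))"
proof -
  let ?V = "coords j" and ?E = "equidistributed X (coords j) u"
  interpret ternary_space ?V by (rule ternary_space_coords)
  have lines: "card (lines ?V) = 3 ^ j * (3 ^ j - 1) div 6"
    using card_lines by (simp add: card_coords)
  have count: "card {B. STS_on X B \<and> f \<in> homs X B ?V} = Psi u ^ (3 ^ j) * Lambda u ^ card (lines ?V)"
    if f: "f \<in> ?E" for f
  proof -
    have fV: "f \<in> X \<rightarrow>\<^sub>E ?V" and u: "\<And>a. a \<in> ?V \<Longrightarrow> card {x \<in> X. f x = a} = u"
      using f by (auto simp: equidistributed_def)
    have "card (blocks_over X f {a}) = Psi u" if "a \<in> ?V" for a
      unfolding blocks_over_singleton[OF fV that] using card_STS_on[of "{x \<in> X. f x = a}"] X(1) u that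
      by simp
    moreover have "card (blocks_over X f l) = Lambda u" if "l \<in> lines ?V" for l
      by (rule card_blocks_over_line[OF X(1) fV that]) (use u that in \<open>auto simp: lines_def\<close>)
    ultimately show ?thesis
      unfolding card_STS_with_hom[OF fV] by (simp add: card_coords)
  qed
  have "(\<Sum>B | STS_on X B. card (surj_homs X B j)) =
      (\<Sum>B | STS_on X B. card {f \<in> ?E. f \<in> homs X B ?V})"
    using surj_homs_eq_equidistributed[OF X _ j] by simp
  also have "\<dots> = (\<Sum>f\<in>?E. card {B \<in> {B. STS_on X B}. f \<in> homs X B ?V})"
    using X finite_V by (intro sum_card_swap STS_on_finite finite_equidistributed)
  also have "\<dots> = card ?E * (Psi u ^ (3 ^ j) * Lambda u ^ card (lines ?V))"
    using count by simp
  finally show ?thesis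
    using card_equidistributed[OF finite_V X(1), of u] j
    by (simp add: card_coords lines mult_ac)
qed

lemma card_dual_STS:
  assumes v: "v > 0" and S: "is_STS v B"
  shows "three_rank v B < v" "card (dual {1..v} B) = 3 ^ (v - three_rank v B - 1 + 1)"
proof -
  let ?r = "three_rank v B" and ?D = "card (dual {1..v} B)"
  have S': "STS_on {1..v} B" using S by (simp add: is_STS_eq_STS_on)
  have c: "?D * 3 ^ ?r = 3 ^ v"
    by (rule card_dual_three_rank) (use STS_on_block(1)[OF S'] in auto)
  \<comment> \<open>\<open>int ?D - 3\<close> is the number of homomorphisms onto
    \<open>coords 1\<close>, hence nonnegative; this stands in for exhibiting the three constant
    functions.\<close>
  have "int ?D - 3 \<ge> 0"
    using card_surj_homs[of "{1..v}" B 1] S' v by simp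
  then have D: "?D \<ge> 3" by simp
  show r: "?r < v"
  proof (rule ccontr)
    assume "\<not> ?r < v"
    then have "(3 :: nat) ^ v \<le> 3 ^ ?r" by (simp add: power_increasing)
    moreover have "3 * 3 ^ ?r \<le> ?D * 3 ^ ?r" using D by simp
    moreover have "(3 :: nat) ^ ?r > 0" by simp
    ultimately show False using c by linarith
  qed
  then have "(3 :: nat) ^ v = 3 ^ (v - ?r - 1 + 1) * 3 ^ ?r"
    by (simp only: power_add[symmetric]) simp
  then show "?D = 3 ^ (v - ?r - 1 + 1)"
    using c by (metis mult_right_cancel power_not_zero zero_neq_numeral)
qed

theorem theorem1:
  fixes v k i :: nat
  assumes "v mod 6 = 1 \<or> v mod 6 = 3"
    and "3 ^ k dvd v" and "\<not> 3 ^ (k + 1) dvd v"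
    and "i \<le> k"
  shows "real (card {B. is_STS v B \<and> three_rank v B = v - i - 1}) =
         Gamma v 0 i * (\<Sum>j = i..k. Gamma v i j * mu3 (j - i) * Phi v j)"
proof -
  let ?X = "{1..v}"
  define \<S> where "\<S> = {B. is_STS v B}"
  define d where "d B = v - three_rank v B - 1" for B
  \<comment> \<open>The inversion coefficient:
    \<open>Gamma v 0 i * Gamma v i j * mu3 (j - i)\<close> stripped of its factorials.\<close>
  define c where "c j = mu3 (j - i) / (3 ^ (Suc j choose 2) * qfact3 i * qfact3 (j - i))" for j
  \<comment> \<open>Maximality of \<open>k\<close> excludes \<open>v = 0\<close>, which every power
    of 3 divides.\<close>
  have v: "v > 0" using assms(3) by (rule contrapos_np) simp
  have X: "finite ?X" "?X \<noteq> {}" using v by auto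
  have fin: "finite \<S>"
    unfolding \<S>_def is_STS_eq_STS_on by (rule STS_on_finite) simp
  have S: "STS_on ?X B" if "B \<in> \<S>" for B
    using that by (simp add: \<S>_def is_STS_eq_STS_on)
  have surj: "real (card (surj_homs ?X B j)) = surj_count (d B) j" if "B \<in> \<S>" for B j
  proof -
    have "card (dual ?X B) = 3 ^ (d B + 1)"
      using card_dual_STS(2)[OF v] that by (simp add: \<S>_def d_def)
    then have "int (card (surj_homs ?X B j)) = (\<Prod>t<j. 3 ^ (d B + 1) - 3 ^ (t + 1))"
      using card_surj_homs[OF X S[OF that], of j] by simp
    then have "real_of_int (int (card (surj_homs ?X B j))) = surj_count (d B) j"
      unfolding surj_count_def by (simp only: of_int_prod of_int_diff of_int_power of_int_numeral)
    then show ?thesis by simp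
  qed
  \<comment> \<open>All factors of \<open>surj_count (d B) (d B)\<close> are positive, so some
    homomorphism is onto a space of \<open>3 ^ d B\<close> points, and its equal fibres make
    \<open>3 ^ d B\<close> divide \<open>v\<close>.\<close>
  have d_le: "d B \<le> k" if B: "B \<in> \<S>" for B
  proof (rule ccontr)
    assume "\<not> d B \<le> k"
    have "surj_count (d B) (d B) > 0"
      unfolding surj_count_def by (intro prod_pos) simp
    then have "surj_homs ?X B (d B) \<noteq> {}"
      using surj[OF B, of "d B"] by (metis card.empty less_irrefl of_nat_0)
    then have "3 ^ d B dvd v"
      using three_power_dvd_of_surj_hom[OF X(1) S[OF B]] by fastforce
    then have "3 ^ (k + 1) dvd v"
      by (rule power_le_dvd) (use \<open>\<not> d B \<le> k\<close> in simp)
    with assms(3) show False ..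
  qed
  \<comment> \<open>Prevents truncation in \<open>v - i - 1\<close>, so that this rank corresponds
    exactly to \<open>d B = i\<close>.\<close>
  have iv: "i < v"
  proof -
    have "i < 3 ^ i" by (rule less_exp[of i, THEN order_less_le_trans]) (simp add: power_mono)
    also have "3 ^ i \<le> (3 :: nat) ^ k" using assms(4) by (simp add: power_increasing)
    also have "\<dots> \<le> v" using assms(2) v by (simp add: dvd_imp_le)
    finally show ?thesis .
  qed
  have summand: "Gamma v 0 i * (Gamma v i j * mu3 (j - i) * Phi v j) =
      c j * (\<Sum>B\<in>\<S>. surj_count (d B) j)" if "j \<in> {i..k}" for j
  proof -
    have ij: "i \<le> j" "j \<le> k" using that by auto
    have "3 ^ j dvd v" using power_le_dvd[OF assms(2) ij(2)] .
    then have "card ?X = 3 ^ j * (v div 3 ^ j)" by simp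
    from sum_card_surj_homs[OF X this] have
      "real ((\<Sum>B\<in>\<S>. card (surj_homs ?X B j)) * fact (v div 3 ^ j) ^ (3 ^ j)) =
        real (fact v * (Psi (v div 3 ^ j) ^ (3 ^ j) * Lambda (v div 3 ^ j) ^ (3 ^ j * (3 ^ j - 1) div 6)))"
      unfolding \<S>_def is_STS_eq_STS_on by simp
    then have "(\<Sum>B\<in>\<S>. surj_count (d B) j) * fact (v div 3 ^ j) ^ (3 ^ j) = fact v * Phi v j"
      using surj by (simp add: Phi_def)
    then have "(\<Sum>B\<in>\<S>. surj_count (d B) j) = fact v * Phi v j / fact (v div 3 ^ j) ^ (3 ^ j)"
      by (simp add: field_simps)
    moreover have "Gamma v 0 i * (Gamma v i j * mu3 (j - i) * Phi v j) =
        (Gamma v 0 i * Gamma v i j) * mu3 (j - i) * Phi v j"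
      by (simp only: mult.assoc)
    ultimately show ?thesis
      unfolding Gamma_mult[OF ij(1), of v] by (simp add: c_def mult_ac)
  qed
  have "Gamma v 0 i * (\<Sum>j = i..k. Gamma v i j * mu3 (j - i) * Phi v j) =
      (\<Sum>j = i..k. c j * (\<Sum>B\<in>\<S>. surj_count (d B) j))"
    by (simp only: sum_distrib_left summand cong: sum.cong)
  also have "\<dots> = (\<Sum>B\<in>\<S>. \<Sum>j = i..k. c j * surj_count (d B) j)"
    by (simp only: sum_distrib_left) (rule sum.swap)
  \<comment> \<open>The combined surjection counts of a single system reduce to the indicator of the
    wanted rank.\<close>
  also have "\<dots> = (\<Sum>B\<in>\<S>. of_bool (d B = i))"
    using gauss3_inversion[OF d_le] by (simp add: c_def)
  also have "\<dots> = real (card {B \<in> \<S>. d B = i})"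
    using fin by (simp add: Collect_conj_eq)
  also have "{B \<in> \<S>. d B = i} = {B. is_STS v B \<and> three_rank v B = v - i - 1}"
  proof -
    have "d B = i \<longleftrightarrow> three_rank v B = v - i - 1" if "is_STS v B" for B
      using card_dual_STS(1)[OF v that] iv unfolding d_def by arith
    then show ?thesis by (auto simp: \<S>_def)
  qed
  finally show ?thesis by simp
qed

end
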